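(* Let $Y$ be a non-trivial metrizable locally convex space, $X$ be a Tychonoff space, and let $E$ be one of the spaces $C_p(X,Y)$, $C^b_p(X,Y)$ or $C^{rc}_p(X,Y)$. Then the following assertions are equivalent: (i) $E$ is a $\kappa$-Fréchet–Urysohn space; (ii) $E^\lambda$ is $\kappa$-Fréchet–Urysohn for every cardinal $\lambda>0$; (iii) $E$ is an Ascoli space; (iv) $E^\lambda$ is Ascoli for every cardinal $\lambda>0$; (v) $E$ is a sequentially Ascoli space; (vi) $E^\lambda$ is sequentially Ascoli for every cardinal $\lambda>0$; (vii) $X$ is either finite or has the property $(\kappa)$; (viii) $E^\lambda$ is $\kappa$-Fréchet–Urysohn (respectively, Ascoli; respectively, sequentially Ascoli) for some cardinal $\lambda>0$ (each of the three versions of this condition being equivalent to the other assertions).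
   Context: $C_p(X,Y)$ is the space of all continuous functions $X\to Y$ with the topology of pointwise convergence; $C^b_p(X,Y)$ and $C^{rc}_p(X,Y)$ are its subspaces of functions $f$ with $f(X)$ bounded in $Y$, respectively relatively compact in $Y$. A space $T$ is $\kappa$-Fréchet–Urysohn if for every open $U\subseteq T$ and every $x\in\overline{U}$ there is a sequence in $U$ converging to $x$. $C_k(T)$ is the space of continuous real-valued functions on $T$ with the compact-open topology. A Tychonoff space $T$ is Ascoli if every compact $K\subseteq C_k(T)$ is evenly continuous (the map $T\times K\to\mathbb{R}$, $(t,f)\mapsto f(t)$, is continuous), and sequentially Ascoli if every convergent sequence in $C_k(T)$ is equicontinuous. $X$ has the property $(\kappa)$ if every pairwise disjoint sequence of finite subsets of $X$ has a strongly point-finite subsequence. Here a family $\{A_i\}_{i\in I}$ of subsets of $X$ is strongly point-finite if there are open sets $U_i\supseteq A_i$ such that for every $x\in X$ the set $\{i\in I: x\in U_i\}$ is finite. *)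

theory Defs
  imports "HOL-Analysis.Analysis"
begin

section \<open>Locally convex spaces\<close>

text \<open>
  The underlying vector space is a whole type, and the vector topology is a separate
  object. Scalars are real; a complex locally convex space is covered via its underlying
  real space, which has the same topology and the same bounded sets. The Hausdorff axiom is not included, as it
  follows from metrizability wherever this predicate is used.
\<close>

definition locally_convex_space :: "'b::real_vector topology \<Rightarrow> bool" where
  "locally_convex_space Y \<longleftrightarrow>
     topspace Y = UNIV \<and>
     continuous_map (prod_topology Y Y) Y (\<lambda>(x, y). x + y) \<and>
     continuous_map (prod_topology euclideanreal Y) Y (\<lambda>(c, x). c *\<^sub>R x) \<and>
     (\<forall>U. openin Y U \<and> 0 \<in> U \<longrightarrow>
        (\<exists>V. openin Y V \<and> 0 \<in> V \<and> convex V \<and> V \<subseteq> U))"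

text \<open>Boundedness is in the sense of von Neumann: every neighbourhood of zero absorbs the set.\<close>

definition bounded_in :: "'b::real_vector topology \<Rightarrow> 'b set \<Rightarrow> bool" where
  "bounded_in Y B \<longleftrightarrow>
     (\<forall>U. openin Y U \<and> 0 \<in> U \<longrightarrow>
        (\<exists>r>0. \<forall>t::real. \<bar>t\<bar> \<ge> r \<longrightarrow> B \<subseteq> (\<lambda>u. t *\<^sub>R u) ` U))"

definition relatively_compact_in :: "'b topology \<Rightarrow> 'b set \<Rightarrow> bool" where
  "relatively_compact_in Y B \<longleftrightarrow> compactin Y (Y closure_of B)"

section \<open>Function spaces\<close>

text \<open>
  Functions on a space \<open>X\<close> are represented by HOL functions that are \<^const>\<open>undefined\<close>
  outside \<open>topspace X\<close>, as in \<^const>\<open>product_topology\<close>; thus two representatives are equal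
  iff they agree on \<open>topspace X\<close>.
\<close>

definition cont_maps :: "'a topology \<Rightarrow> 'b topology \<Rightarrow> ('a \<Rightarrow> 'b) set" where
  "cont_maps X Y = {f \<in> extensional (topspace X). continuous_map X Y f}"

definition Cp :: "'a topology \<Rightarrow> 'b topology \<Rightarrow> ('a \<Rightarrow> 'b) topology" where
  "Cp X Y = subtopology (product_topology (\<lambda>_. Y) (topspace X)) (cont_maps X Y)"

definition Cpb :: "'a topology \<Rightarrow> 'b::real_vector topology \<Rightarrow> ('a \<Rightarrow> 'b) topology" where
  "Cpb X Y = subtopology (Cp X Y) {f. bounded_in Y (f ` topspace X)}"

definition Cprc :: "'a topology \<Rightarrow> 'b topology \<Rightarrow> ('a \<Rightarrow> 'b) topology" where
  "Cprc X Y = subtopology (Cp X Y) {f. relatively_compact_in Y (f ` topspace X)}"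

text \<open>
  The compact-open topology on real-valued continuous functions. The compact set
  \<open>K = {}\<close> makes the whole of \<open>cont_maps T euclideanreal\<close> a member of the subbase.
\<close>

definition Ck :: "'a topology \<Rightarrow> ('a \<Rightarrow> real) topology" where
  "Ck T = topology_generated_by
     {{f \<in> cont_maps T euclideanreal. f ` K \<subseteq> U} | K U. compactin T K \<and> open U}"

text \<open>
  \<open>power_top E I\<close> is \<open>E\<close> to the power \<open>\<lambda>\<close>, where the cardinal \<open>\<lambda>\<close> is that of the index set \<open>I\<close>.
  Every cardinal arises in this way as the type of indices varies.
\<close>

definition power_top :: "'c topology \<Rightarrow> 'i set \<Rightarrow> ('i \<Rightarrow> 'c) topology" where
  "power_top E I = product_topology (\<lambda>_. E) I"

section \<open>Properties of topological spaces\<close>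

definition tychonoff_space :: "'a topology \<Rightarrow> bool" where
  "tychonoff_space X \<longleftrightarrow> completely_regular_space X \<and> Hausdorff_space X"

definition kappa_Frechet_Urysohn :: "'a topology \<Rightarrow> bool" where
  "kappa_Frechet_Urysohn T \<longleftrightarrow>
     (\<forall>U x. openin T U \<and> x \<in> T closure_of U \<longrightarrow>
        (\<exists>s::nat \<Rightarrow> 'a. range s \<subseteq> U \<and> limitin T s x sequentially))"

definition evenly_continuous :: "'a topology \<Rightarrow> ('a \<Rightarrow> real) set \<Rightarrow> bool" where
  "evenly_continuous T K \<longleftrightarrow>
     continuous_map (prod_topology T (subtopology (Ck T) K)) euclideanreal (\<lambda>(t, f). f t)"

definition ascoli_space :: "'a topology \<Rightarrow> bool" where
  "ascoli_space T \<longleftrightarrow>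
     tychonoff_space T \<and> (\<forall>K. compactin (Ck T) K \<longrightarrow> evenly_continuous T K)"

definition equicontinuous :: "'a topology \<Rightarrow> ('a \<Rightarrow> real) set \<Rightarrow> bool" where
  "equicontinuous T F \<longleftrightarrow>
     (\<forall>x \<in> topspace T. \<forall>e>0. \<exists>U. openin T U \<and> x \<in> U \<and>
        (\<forall>f \<in> F. \<forall>y \<in> U. \<bar>f y - f x\<bar> < e))"

text \<open>
  \<^const>\<open>limitin\<close> constrains a sequence only eventually, so membership of all its terms in
  the function space is required separately.
\<close>

definition sequentially_ascoli_space :: "'a topology \<Rightarrow> bool" where
  "sequentially_ascoli_space T \<longleftrightarrow>
     tychonoff_space T \<and>
     (\<forall>(f::nat \<Rightarrow> 'a \<Rightarrow> real) g.
        range f \<subseteq> topspace (Ck T) \<and> limitin (Ck T) f g sequentially \<longrightarrow>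
        equicontinuous T (range f))"

definition strongly_point_finite :: "'a topology \<Rightarrow> ('i \<Rightarrow> 'a set) \<Rightarrow> 'i set \<Rightarrow> bool" where
  "strongly_point_finite X A I \<longleftrightarrow>
     (\<exists>U. (\<forall>i\<in>I. openin X (U i) \<and> A i \<subseteq> U i) \<and>
          (\<forall>x \<in> topspace X. finite {i \<in> I. x \<in> U i}))"

definition property_kappa :: "'a topology \<Rightarrow> bool" where
  "property_kappa X \<longleftrightarrow>
     (\<forall>A::nat \<Rightarrow> 'a set.
        (\<forall>n. finite (A n) \<and> A n \<subseteq> topspace X) \<and> disjoint_family A \<longrightarrow>
        (\<exists>r::nat \<Rightarrow> nat. strict_mono r \<and> strongly_point_finite X (A \<circ> r) UNIV))"

end

theory Submission
  imports Defs "HOL-Library.Diagonal_Subsequence"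
begin

text \<open>
  Every Tychonoff \<open>\<kappa>\<close>-Frechet-Urysohn space is Ascoli, every Ascoli space is sequentially Ascoli,
  and a power \<open>E\<^sup>\<lambda>\<close> has \<open>E\<close> as a retract, so it suffices to derive the
  \<open>\<kappa>\<close>-Frechet-Urysohn property of all powers from \<open>(\<kappa>)\<close> and \<open>(\<kappa>)\<close> from the sequential Ascoli
  property of \<open>E\<close>. Open sets of \<open>E\<^sup>\<lambda>\<close> are determined by finitely many points of the
  disjoint sum of \<open>\<lambda>\<close> copies of \<open>X\<close>, and this sum inherits \<open>(\<kappa>)\<close>; a strongly point-finite
  expansion of the points at which approximating functions still differ from their limit allows
  one to cut these functions off so that they converge. Conversely, for a disjoint sequence
  \<open>A n\<close> without strongly point-finite subsequence, products over \<open>A n\<close> of bump functions that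
  escape to infinity in \<open>Y\<close> converge to zero in \<open>C\<^sub>k(E)\<close> without being equicontinuous.
  A finite \<open>X\<close> has \<open>(\<kappa>)\<close> because all but finitely many \<open>A n\<close> are empty.
\<close>

lemma continuous_map_real_iff:
  "continuous_map T euclideanreal f \<longleftrightarrow>
    (\<forall>x\<in>topspace T. \<forall>e>0. \<exists>U. openin T U \<and> x \<in> U \<and> (\<forall>y\<in>U. \<bar>f y - f x\<bar> < e))"
  using Met_TC.continuous_map_to_metric [of T f]
  by (simp add: dist_real_def abs_minus_commute)

section \<open>The compact-open topology\<close>

lemma topspace_Ck: "topspace (Ck T) = cont_maps T euclideanreal"
proof
  show "topspace (Ck T) \<subseteq> cont_maps T euclideanreal"
    unfolding Ck_def by auto
  have "cont_maps T euclideanreal \<in>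
      {{f \<in> cont_maps T euclideanreal. f ` K \<subseteq> U} | K U. compactin T K \<and> open U}"
    by (auto intro!: exI[of _ "{}"])
  then show "cont_maps T euclideanreal \<subseteq> topspace (Ck T)"
    unfolding Ck_def topology_generated_by_topspace by (rule Union_upper)
qed

lemma openin_Ck:
  assumes "compactin T K" "open U"
  shows "openin (Ck T) {f \<in> cont_maps T euclideanreal. f ` K \<subseteq> U}"
  unfolding Ck_def using assms by (intro topology_generated_by_Basis) auto

lemma openin_Ck_point:
  assumes "x \<in> topspace T" "open U"
  shows "openin (Ck T) {f \<in> cont_maps T euclideanreal. f x \<in> U}"
  using openin_Ck[of T "{x}" U] assms by simp

text \<open>Eventual membership passes through finite intersections and arbitrary unions, so
  convergence can be tested on the subbasic sets.\<close>

lemma limitin_Ck_iff: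
  "limitin (Ck T) f g F \<longleftrightarrow> g \<in> cont_maps T euclideanreal \<and>
    (\<forall>K U. compactin T K \<and> open U \<and> g ` K \<subseteq> U \<longrightarrow>
       (\<forall>\<^sub>F n in F. f n \<in> cont_maps T euclideanreal \<and> f n ` K \<subseteq> U))"
    (is "?lhs \<longleftrightarrow> _ \<and> ?rhs")
proof (intro iffI conjI)
  assume L: ?lhs
  then show g: "g \<in> cont_maps T euclideanreal"
    using limitin_topspace by (fastforce simp: topspace_Ck)
  show ?rhs
  proof (intro allI impI)
    fix K U assume "compactin T K \<and> open U \<and> g ` K \<subseteq> U"
    then show "\<forall>\<^sub>F n in F. f n \<in> cont_maps T euclideanreal \<and> f n ` K \<subseteq> U"
      using limitinD[OF L openin_Ck[of T K U]] g by simp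
  qed
next
  assume R: "g \<in> cont_maps T euclideanreal \<and> ?rhs"
  have "\<forall>\<^sub>F n in F. f n \<in> W" if "openin (Ck T) W" "g \<in> W" for W
  proof -
    have "generate_topology_on
        {{f \<in> cont_maps T euclideanreal. f ` K \<subseteq> U} | K U. compactin T K \<and> open U} W"
      using that unfolding Ck_def by (intro openin_topology_generated_by)
    then show ?thesis
      using \<open>g \<in> W\<close>
    proof induction
      case (Int a b)
      then show ?case by (simp add: eventually_conj)
    next
      case (UN \<W>)
      then obtain W' where "W' \<in> \<W>" "\<forall>\<^sub>F n in F. f n \<in> W'" by blast
      then show ?case by (auto elim: eventually_mono)
    next
      case (Basis s)
      then obtain K U where "s = {f \<in> cont_maps T euclideanreal. f ` K \<subseteq> U}"
        "compactin T K" "open U" by blast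
      then show ?case using R Basis.prems by simp
    qed simp
  qed
  then show ?lhs
    using R by (simp add: limitin_def topspace_Ck)
qed

section \<open>Ascoli and \<open>\<kappa>\<close>-Frechet-Urysohn spaces\<close>

text \<open>If every point of \<open>K\<close> had a neighbourhood that \<open>s\<close> eventually
  avoids, finitely many of these would cover \<open>K\<close>. Cluster points stand in for
  convergent subsequences, since compact subsets of \<open>Ck T\<close> need not be sequentially
  compact.\<close>

lemma compactin_sequence_cluster_point:
  assumes "compactin T K" "range s \<subseteq> K"
  obtains x where "x \<in> K" "\<And>U. openin T U \<Longrightarrow> x \<in> U \<Longrightarrow> \<exists>\<^sub>F n in sequentially. s n \<in> U"
proof (rule ccontr)
  assume "\<not> thesis"
  then have "\<forall>x\<in>K. \<exists>U. openin T U \<and> x \<in> U \<and> \<not> (\<exists>\<^sub>F n in sequentially. s n \<in> U)"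
    using that by blast
  then obtain U where U: "\<And>x. x \<in> K \<Longrightarrow>
      openin T (U x) \<and> x \<in> U x \<and> (\<forall>\<^sub>F n in sequentially. s n \<notin> U x)"
    unfolding not_frequently by metis
  then have "\<forall>V\<in>U ` K. openin T V" "K \<subseteq> \<Union>(U ` K)" by blast+
  then have "\<exists>\<F>. finite \<F> \<and> \<F> \<subseteq> U ` K \<and> K \<subseteq> \<Union>\<F>"
    using \<open>compactin T K\<close> unfolding compactin_def by blast
  then obtain C where C: "finite C" "C \<subseteq> K" "K \<subseteq> \<Union>(U ` C)"
    by (metis finite_subset_image)
  then have "\<forall>\<^sub>F n in sequentially. \<forall>x\<in>C. s n \<notin> U x"
    using U C(2) by (intro eventually_ball_finite C(1) ballI) blast
  from eventually_happens'[OF sequentially_bot this]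
  obtain n where "\<forall>x\<in>C. s n \<notin> U x" ..
  moreover have "s n \<in> \<Union>(U ` C)"
    using C assms(2) by blast
  ultimately show False by blast
qed

text \<open>
  A failure of equicontinuity at \<open>x\<close> puts \<open>x\<close> in the closure of an open set; a sequence \<open>s\<close>
  in that set converging to \<open>x\<close> is witnessed by functions \<open>f n\<close>, and a cluster point of the
  \<open>f n\<close> contradicts uniform closeness on a tail of \<open>s\<close> together with its limit.
\<close>
lemma kappa_Frechet_Urysohn_compactin_equicontinuous:
  assumes T: "kappa_Frechet_Urysohn T" and K: "compactin (Ck T) K"
  shows "equicontinuous T K"
  unfolding equicontinuous_def
proof (intro ballI allI impI, rule ccontr)
  fix x and e :: real
  assume x: "x \<in> topspace T" and "e > 0"
  assume neg: "\<nexists>U. openin T U \<and> x \<in> U \<and> (\<forall>f\<in>K. \<forall>y\<in>U. \<bar>f y - f x\<bar> < e)"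
  have cont: "continuous_map T euclideanreal f" if "f \<in> K" for f
    using compactin_subset_topspace[OF K] that by (auto simp: topspace_Ck cont_maps_def)
  \<comment> \<open>The points at which some member of \<open>K\<close> differs from its value at
    \<open>x\<close> by more than \<open>e/2\<close>; without equicontinuity every neighbourhood of
    \<open>x\<close> meets this open set.\<close>
  define V where "V = (\<Union>f\<in>K. {y \<in> topspace T. \<bar>f y - f x\<bar> \<in> {e/2<..}})"
  have "openin T V"
    unfolding V_def
    by (intro openin_Union ballI; clarify;
        intro openin_continuous_map_preimage[where Y = euclideanreal] continuous_intros)
       (auto intro!: cont continuous_map_diff continuous_map_real_abs)
  moreover have "x \<in> T closure_of V"
    unfolding in_closure_of
  proof (intro conjI allI impI x)
    fix U assume U: "x \<in> U \<and> openin T U"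
    then obtain f y where "f \<in> K" "y \<in> U" "\<not> \<bar>f y - f x\<bar> < e"
      using neg by blast
    moreover have "y \<in> topspace T"
      using U \<open>y \<in> U\<close> openin_subset by blast
    ultimately show "\<exists>y. y \<in> V \<and> y \<in> U"
      unfolding V_def using \<open>e > 0\<close> by force
  qed
  ultimately obtain s where s: "range s \<subseteq> V" and lim: "limitin T s x sequentially"
    using T unfolding kappa_Frechet_Urysohn_def by blast
  then have "\<forall>n. \<exists>f\<in>K. \<bar>f (s n) - f x\<bar> > e/2"
    unfolding V_def by fastforce
  then obtain f where f: "\<And>n. f n \<in> K" "\<And>n. \<bar>f n (s n) - f n x\<bar> > e/2"
    by metis
  obtain h where "h \<in> K"
    and h: "\<And>W. openin (Ck T) W \<Longrightarrow> h \<in> W \<Longrightarrow> \<exists>\<^sub>F n in sequentially. f n \<in> W"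
    using compactin_sequence_cluster_point[OF K, of f] f(1) by blast
  have "limitin euclideanreal (h \<circ> s) (h x) sequentially"
    using continuous_map_limit[OF cont[OF \<open>h \<in> K\<close>] lim] .
  then obtain N where N: "\<And>n. n \<ge> N \<Longrightarrow> \<bar>h (s n) - h x\<bar> < e/4"
    using \<open>e > 0\<close> unfolding limitin_canonical_iff LIMSEQ_def dist_real_def o_def
    by (metis zero_less_divide_iff zero_less_numeral)
  \<comment> \<open>Only the tail from \<open>N\<close> on, where \<open>h\<close> stays within
    \<open>e/4\<close> of \<open>h x\<close>: then \<open>h\<close> lies in the open set of
    functions mapping the compact \<open>S\<close> into that ball. Some \<open>f n\<close> with
    \<open>n \<ge> N\<close> lies there too, so its values at \<open>x\<close> and
    \<open>s n\<close> differ by less than \<open>e/2\<close>.\<close>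
  define S where "S = insert x (s ` {N..})"
  have "compactin T S"
    unfolding S_def
    by (rule compactin_sequence_with_limit[OF lim])
       (use s \<open>openin T V\<close> openin_subset in fastforce)+
  then have "openin (Ck T) {g \<in> cont_maps T euclideanreal. g ` S \<subseteq> ball (h x) (e/4)}"
    by (intro openin_Ck) auto
  moreover have "h \<in> {g \<in> cont_maps T euclideanreal. g ` S \<subseteq> ball (h x) (e/4)}"
    using compactin_subset_topspace[OF K] \<open>h \<in> K\<close> N \<open>e > 0\<close>
    by (auto simp: S_def topspace_Ck dist_real_def abs_minus_commute)
  ultimately have "\<exists>\<^sub>F n in sequentially. f n ` S \<subseteq> ball (h x) (e/4)"
    using h by (fastforce elim: frequently_elim1)
  then obtain n where n: "n \<ge> N" "f n ` S \<subseteq> ball (h x) (e/4)"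
    by (meson frequently_sequentially)
  then have "f n x \<in> ball (h x) (e/4)" "f n (s n) \<in> ball (h x) (e/4)"
    unfolding S_def by blast+
  then have "\<bar>h x - f n x\<bar> < e/4" "\<bar>h x - f n (s n)\<bar> < e/4"
    by (simp_all add: dist_real_def)
  with f(2)[of n] show False by linarith
qed

text \<open>The difference \<open>g y - f x\<close> splits into \<open>g y - g x\<close>, small by
  equicontinuity, and \<open>g x - f x\<close>, small on the subbasic neighbourhood of
  \<open>f\<close> given by the compact set \<open>{x}\<close>.\<close>

lemma equicontinuous_imp_evenly_continuous:
  assumes "equicontinuous T K" "K \<subseteq> topspace (Ck T)"
  shows "evenly_continuous T K"
  unfolding evenly_continuous_def continuous_map_real_iff
proof (clarsimp simp: topspace_prod_topology)
  fix x f and e :: real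
  assume x: "x \<in> topspace T" and "f \<in> topspace (Ck T)" "f \<in> K" "e > 0"
  then obtain U where U: "openin T U" "x \<in> U" "\<And>g y. g \<in> K \<Longrightarrow> y \<in> U \<Longrightarrow> \<bar>g y - g x\<bar> < e/2"
    using assms(1) unfolding equicontinuous_def by (metis half_gt_zero)
  define W where "W = {g \<in> cont_maps T euclideanreal. g x \<in> ball (f x) (e/2)}"
  have "openin (prod_topology T (subtopology (Ck T) K)) (U \<times> (W \<inter> K))"
    using U(1) openin_Ck_point[OF x, of "ball (f x) (e/2)"]
    by (auto simp: openin_prod_Times_iff openin_subtopology_Int W_def)
  moreover have "(x, f) \<in> U \<times> (W \<inter> K)"
    using U(2) \<open>f \<in> topspace (Ck T)\<close> \<open>f \<in> K\<close> \<open>e > 0\<close> by (simp add: W_def topspace_Ck)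
  moreover have "\<bar>g y - f x\<bar> < e" if "y \<in> U" "g \<in> W \<inter> K" for y g
  proof -
    have "\<bar>g y - g x\<bar> < e/2" "\<bar>f x - g x\<bar> < e/2"
      using U(3)[of g y] that by (simp_all add: W_def dist_real_def)
    then show ?thesis by linarith
  qed
  ultimately show "\<exists>U. openin (prod_topology T (subtopology (Ck T) K)) U \<and> (x, f) \<in> U \<and>
      (\<forall>y\<in>U. \<bar>(case y of (t, f) \<Rightarrow> f t) - f x\<bar> < e)"
    by (intro exI[of _ "U \<times> (W \<inter> K)"]) auto
qed

lemma kappa_Frechet_Urysohn_imp_ascoli_space:
  assumes "tychonoff_space T" "kappa_Frechet_Urysohn T"
  shows "ascoli_space T"
  using assms kappa_Frechet_Urysohn_compactin_equicontinuous equicontinuous_imp_evenly_continuous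
    compactin_subset_topspace unfolding ascoli_space_def by blast

text \<open>The sequence together with its limit is compact, hence evenly continuous. At
  \<open>(x, g)\<close> this controls all but finitely many terms at once near \<open>x\<close>; the
  remaining terms are handled one by one by their continuity.\<close>

lemma ascoli_space_imp_sequentially_ascoli_space:
  assumes "ascoli_space T"
  shows "sequentially_ascoli_space T"
  unfolding sequentially_ascoli_space_def
proof (intro conjI allI impI)
  show "tychonoff_space T"
    using assms by (simp add: ascoli_space_def)
  fix f :: "nat \<Rightarrow> 'a \<Rightarrow> real" and g
  assume fg: "range f \<subseteq> topspace (Ck T) \<and> limitin (Ck T) f g sequentially"
  define K where "K = insert g (range f)"
  have "compactin (Ck T) K"
    using fg unfolding K_def by (intro compactin_sequence_with_limit) auto
  then have "evenly_continuous T K"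
    using assms by (simp add: ascoli_space_def)
  then have cont: "continuous_map (prod_topology T (subtopology (Ck T) K)) euclideanreal (\<lambda>(t, f). f t)"
    by (simp add: evenly_continuous_def)
  have g: "g \<in> topspace (Ck T)"
    using limitin_topspace[OF conjunct2[OF fg]] .
  show "equicontinuous T (range f)"
    unfolding equicontinuous_def
  proof (intro ballI allI impI)
    fix x and e :: real assume x: "x \<in> topspace T" and "e > 0"
    have "(x, g) \<in> topspace (prod_topology T (subtopology (Ck T) K))"
      using x g by (simp add: K_def)
    from cont[unfolded continuous_map_real_iff, rule_format, OF this half_gt_zero[OF \<open>e > 0\<close>]]
    obtain P where P: "openin (prod_topology T (subtopology (Ck T) K)) P" "(x, g) \<in> P"
      and P': "\<forall>z\<in>P. \<bar>snd z (fst z) - g x\<bar> < e/2"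
      by (auto simp: split_beta)
    have P_less: "\<bar>h y - g x\<bar> < e/2" if "(y, h) \<in> P" for y h
      using bspec[OF P' that] by simp
    from P obtain V W where VW: "openin T V" "openin (subtopology (Ck T) K) W" "x \<in> V" "g \<in> W" "V \<times> W \<subseteq> P"
      unfolding openin_prod_topology_alt by meson
    have "limitin (subtopology (Ck T) K) f g sequentially"
      using fg by (simp add: limitin_subtopology K_def)
    then obtain N where N: "\<And>n. n \<ge> N \<Longrightarrow> f n \<in> W"
      using VW unfolding limitin_sequentially by blast
    have "\<exists>U. openin T U \<and> x \<in> U \<and> (\<forall>y\<in>U. \<bar>f n y - f n x\<bar> < e)" for n
      using fg x \<open>e > 0\<close> unfolding topspace_Ck cont_maps_def by (auto simp: continuous_map_real_iff)
    then obtain U where U: "\<And>n. openin T (U n)" "\<And>n. x \<in> U n"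
      "\<And>n y. y \<in> U n \<Longrightarrow> \<bar>f n y - f n x\<bar> < e" by metis
    have "openin T (V \<inter> \<Inter>(U ` {..<N}))"
      using VW(1) U(1) by (cases "N = 0") (auto intro!: openin_Int openin_Inter)
    moreover have "\<bar>f n y - f n x\<bar> < e" if "y \<in> V \<inter> \<Inter>(U ` {..<N})" for n y
    proof (cases "n < N")
      case False
      then have "(y, f n) \<in> P" "(x, f n) \<in> P"
        using that N[of n] VW by auto
      then show ?thesis using P_less[of y "f n"] P_less[of x "f n"] by linarith
    qed (use U(3) that in auto)
    ultimately show "\<exists>U. openin T U \<and> x \<in> U \<and> (\<forall>f\<in>range f. \<forall>y\<in>U. \<bar>f y - f x\<bar> < e)"
      using VW(3) U(2) by (intro exI[of _ "V \<inter> \<Inter>(U ` {..<N})"]) auto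
  qed
qed

section \<open>Passage to retracts\<close>

text \<open>\<open>q\<close> maps \<open>U\<close> into the preimage \<open>V\<close> of
  \<open>U\<close> under \<open>p\<close>, so \<open>q x\<close> lies in the closure of
  \<open>V\<close>; applying \<open>p\<close> to a sequence in \<open>V\<close> that converges to
  \<open>q x\<close> gives one in \<open>U\<close> that converges to \<open>x\<close>.\<close>

lemma kappa_Frechet_Urysohn_retraction:
  assumes p: "continuous_map S T p" and q: "continuous_map T S q"
    and pq: "\<And>x. x \<in> topspace T \<Longrightarrow> p (q x) = x" and S: "kappa_Frechet_Urysohn S"
  shows "kappa_Frechet_Urysohn T"
  unfolding kappa_Frechet_Urysohn_def
proof (intro allI impI)
  fix U x assume Ux: "openin T U \<and> x \<in> T closure_of U"
  then have x: "x \<in> topspace T" by (simp add: in_closure_of)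
  define V where "V = {y \<in> topspace S. p y \<in> U}"
  have "openin S V"
    unfolding V_def using p Ux openin_continuous_map_preimage by blast
  moreover have "q ` U \<subseteq> V"
    using Ux pq continuous_map_image_subset_topspace[OF q] openin_subset[of T U]
    by (fastforce simp: V_def)
  then have "q x \<in> S closure_of V"
    using continuous_map_image_closure_subset[OF q, of U] Ux closure_of_mono by blast
  ultimately obtain s where s: "range s \<subseteq> V" "limitin S s (q x) sequentially"
    using S unfolding kappa_Frechet_Urysohn_def by blast
  then have "limitin T (p \<circ> s) x sequentially"
    using continuous_map_limit[OF p s(2)] pq[OF x] by simp
  moreover have "range (p \<circ> s) \<subseteq> U"
    using s(1) by (auto simp: V_def)
  ultimately show "\<exists>s::nat \<Rightarrow> _. range s \<subseteq> U \<and> limitin T s x sequentially" by blast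
qed

text \<open>Composition with \<open>p\<close> preserves convergence in the compact-open topology,
  since \<open>p\<close> sends compact sets to compact sets. Equicontinuity of the lifted functions
  is then pulled back along \<open>q\<close>, because \<open>lift h\<close> after \<open>q\<close>
  is \<open>h\<close> on \<open>T\<close>.\<close>

lemma sequentially_ascoli_space_retraction:
  assumes p: "continuous_map S T p" and q: "continuous_map T S q"
    and pq: "\<And>x. x \<in> topspace T \<Longrightarrow> p (q x) = x"
    and T: "tychonoff_space T" and S: "sequentially_ascoli_space S"
  shows "sequentially_ascoli_space T"
  unfolding sequentially_ascoli_space_def
proof (intro conjI allI impI T)
  fix f :: "nat \<Rightarrow> 'b \<Rightarrow> real" and g
  assume fg: "range f \<subseteq> topspace (Ck T) \<and> limitin (Ck T) f g sequentially"
  define lift :: "('b \<Rightarrow> real) \<Rightarrow> 'a \<Rightarrow> real" where "lift = (\<lambda>h. restrict (h \<circ> p) (topspace S))"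
  have lift: "lift h \<in> cont_maps S euclideanreal" if "h \<in> cont_maps T euclideanreal" for h
    using that continuous_map_compose[OF p, of euclideanreal h]
    by (auto simp: lift_def cont_maps_def intro: continuous_map_eq)
  have image_lift: "lift h ` K = h ` p ` K" if "compactin S K" for h K
    using compactin_subset_topspace[OF that] by (force simp: lift_def)
  have "limitin (Ck S) (\<lambda>n. lift (f n)) (lift g) sequentially"
    unfolding limitin_Ck_iff
  proof (intro conjI allI impI)
    show "lift g \<in> cont_maps S euclideanreal"
      using fg lift by (simp add: limitin_Ck_iff)
    fix K U assume KU: "compactin S K \<and> open U \<and> lift g ` K \<subseteq> U"
    then have "\<forall>\<^sub>F n in sequentially. f n \<in> cont_maps T euclideanreal \<and> f n ` p ` K \<subseteq> U"
      using fg image_compactin[OF _ p] by (auto simp: limitin_Ck_iff image_lift)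
    then show "\<forall>\<^sub>F n in sequentially. lift (f n) \<in> cont_maps S euclideanreal \<and> lift (f n) ` K \<subseteq> U"
      by (rule eventually_mono) (use KU lift in \<open>auto simp: image_lift\<close>)
  qed
  moreover have "range (\<lambda>n. lift (f n)) \<subseteq> topspace (Ck S)"
    using fg lift by (auto simp: topspace_Ck)
  ultimately have eq: "equicontinuous S (range (\<lambda>n. lift (f n)))"
    using S unfolding sequentially_ascoli_space_def by blast
  show "equicontinuous T (range f)"
    unfolding equicontinuous_def
  proof (intro ballI allI impI)
    fix x and e :: real assume x: "x \<in> topspace T" and "e > 0"
    have qS: "q y \<in> topspace S" if "y \<in> topspace T" for y
      using continuous_map_image_subset_topspace[OF q] that by blast
    obtain U where U: "openin S U" "q x \<in> U" "\<And>n y. y \<in> U \<Longrightarrow> \<bar>lift (f n) y - lift (f n) (q x)\<bar> < e"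
      using eq qS[OF x] \<open>e > 0\<close> unfolding equicontinuous_def by (metis rangeI)
    have lift_q: "lift h (q y) = h y" if "y \<in> topspace T" for h y
      using that qS pq by (simp add: lift_def)
    have "openin T {y \<in> topspace T. q y \<in> U}"
      using q U(1) openin_continuous_map_preimage by blast
    moreover have "\<bar>f n y - f n x\<bar> < e" if "y \<in> topspace T" "q y \<in> U" for n y
      using U(3)[OF that(2)] lift_q that(1) x by simp
    ultimately show "\<exists>U. openin T U \<and> x \<in> U \<and> (\<forall>f\<in>range f. \<forall>y\<in>U. \<bar>f y - f x\<bar> < e)"
      using x U(2) by (intro exI[of _ "{y \<in> topspace T. q y \<in> U}"]) auto
  qed
qed

section \<open>Property \<open>(\<kappa>)\<close>\<close>

lemma strongly_point_finite_subseq: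
  fixes r :: "nat \<Rightarrow> nat"
  assumes "strongly_point_finite X A UNIV" "strict_mono r"
  shows "strongly_point_finite X (A \<circ> r) UNIV"
proof -
  obtain U where U: "\<And>n. openin X (U n) \<and> A n \<subseteq> U n"
    "\<And>x. x \<in> topspace X \<Longrightarrow> finite {n. x \<in> U n}"
    using assms(1) unfolding strongly_point_finite_def by auto
  have "finite {n. x \<in> U (r n)}" if "x \<in> topspace X" for x
    using finite_vimageI[OF U(2)[OF that] strict_mono_imp_inj_on[OF assms(2)]]
    by (simp add: vimage_def)
  then show ?thesis
    unfolding strongly_point_finite_def using U(1) by (intro exI[of _ "U \<circ> r"]) auto
qed

text \<open>The first \<open>m\<close> sets may be covered by the whole space: this adds at most
  \<open>m\<close> indices at every point.\<close>

lemma strongly_point_finite_offset: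
  assumes A: "\<And>n. A n \<subseteq> topspace X" and "strongly_point_finite X (A \<circ> (+) m) UNIV"
  shows "strongly_point_finite X A (UNIV :: nat set)"
proof -
  obtain U where U: "\<And>n. openin X (U n) \<and> A (m + n) \<subseteq> U n"
    "\<And>x. x \<in> topspace X \<Longrightarrow> finite {n. x \<in> U n}"
    using assms(2) unfolding strongly_point_finite_def by auto
  define V where "V = (\<lambda>n. if n < m then topspace X else U (n - m))"
  have "openin X (V n) \<and> A n \<subseteq> V n" for n
    using U(1)[of "n - m"] A[of n] by (auto simp: V_def)
  moreover have "finite {n. x \<in> V n}" if "x \<in> topspace X" for x
  proof (rule finite_subset)
    show "{n. x \<in> V n} \<subseteq> {..<m} \<union> (+) m ` {n. x \<in> U n}"
    proof (intro subsetI, clarsimp simp: not_less)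
      fix n assume "x \<in> V n" "n \<notin> (+) m ` {n. x \<in> U n}"
      then show "n < m"
        by (metis V_def add_diff_inverse_nat image_eqI mem_Collect_eq)
    qed
  qed (use U(2)[OF that] in simp)
  ultimately show ?thesis
    unfolding strongly_point_finite_def by (intro exI[of _ V]) auto
qed

lemma property_kappaE:
  assumes "property_kappa X"
    and "\<And>n. finite (A n)" "\<And>n. A n \<subseteq> topspace X" "disjoint_family A"
  obtains r :: "nat \<Rightarrow> nat"
  where "strict_mono r" "strongly_point_finite X (\<lambda>n. A (r n)) UNIV"
proof -
  have "\<exists>r::nat \<Rightarrow> nat. strict_mono r \<and> strongly_point_finite X (A \<circ> r) UNIV"
    using assms(1)[unfolded property_kappa_def, rule_format, of A] assms(2-4) by blast
  then show thesis
    using that by (auto simp: o_def)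
qed

lemma property_kappa_finite:
  assumes "finite (topspace X)"
  shows "property_kappa X"
  unfolding property_kappa_def
proof (intro allI impI)
  fix A :: "nat \<Rightarrow> 'a set"
  assume A: "(\<forall>n. finite (A n) \<and> A n \<subseteq> topspace X) \<and> disjoint_family A"
  have "strongly_point_finite X A UNIV"
    unfolding strongly_point_finite_def
  proof (intro exI[of _ "\<lambda>n. if A n = {} then {} else topspace X"] conjI ballI)
    fix x assume "x \<in> topspace X"
    \<comment> \<open>Non-empty members of a disjoint family are distinct, and a finite space has
      only finitely many subsets.\<close>
    have "inj_on A {n. A n \<noteq> {}}"
      using A by (fastforce simp: inj_on_def disjoint_family_on_def)
    moreover have "finite (A ` {n. A n \<noteq> {}})"
    proof (rule finite_subset)
      show "A ` {n. A n \<noteq> {}} \<subseteq> Pow (topspace X)" using A by blast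
    qed (simp add: assms)
    ultimately have "finite {n. A n \<noteq> {}}"
      using finite_imageD by blast
    then show "finite {n \<in> UNIV. x \<in> (if A n = {} then {} else topspace X)}"
      by (rule rev_finite_subset) auto
  qed (use A in auto)
  then show "\<exists>r::nat \<Rightarrow> nat. strict_mono r \<and> strongly_point_finite X (A \<circ> r) UNIV"
    by (intro exI[of _ id]) (auto simp: strict_mono_def)
qed

text \<open>
  A sequence of finite sets meets only countably many summands, so a diagonal argument over
  these yields a subsequence that works in every summand at once.
\<close>
lemma property_kappa_sum_topology:
  assumes kappa: "\<And>i. i \<in> I \<Longrightarrow> property_kappa (X i)"
  shows "property_kappa (sum_topology X I)"
  unfolding property_kappa_def
proof (intro allI impI)
  fix A :: "nat \<Rightarrow> ('a \<times> 'b) set"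
  assume "(\<forall>n. finite (A n) \<and> A n \<subseteq> topspace (sum_topology X I)) \<and> disjoint_family A"
  then have fin: "\<And>n. finite (A n)" and sub: "\<And>n. A n \<subseteq> Sigma I (topspace \<circ> X)"
    and disj: "disjoint_family A" by auto
  define J where "J = fst ` (\<Union>n. A n)"
  define e where "e = from_nat_into J"
  define Q where "Q = (\<lambda>i s. strongly_point_finite (X i) (\<lambda>n. Pair i -` A (s n)) (UNIV :: nat set))"
  have "countable J"
    unfolding J_def using fin by (intro countable_image countable_UN) (auto intro: countable_finite)
  have "J \<subseteq> I"
    using sub unfolding J_def by fastforce
  have top: "Pair i -` A n \<subseteq> topspace (X i)" for i n
    using sub[of n] by auto
  \<comment> \<open>The guard \<open>e j \<in> J\<close> covers the case of empty \<open>J\<close>,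
    in which the enumeration \<open>e\<close> takes unspecified values.\<close>
  interpret subseqs "\<lambda>j s. e j \<in> J \<longrightarrow> Q (e j) s"
  proof
    fix j and s :: "nat \<Rightarrow> nat" assume s: "strict_mono s"
    show "\<exists>r'. strict_mono r' \<and> (e j \<in> J \<longrightarrow> Q (e j) (s \<circ> r'))"
    proof (cases "e j \<in> J")
      case True
      have "disjoint_family (\<lambda>n. Pair (e j) -` A (s n))"
        unfolding disjoint_family_on_def
      proof (intro ballI impI)
        fix m n :: nat assume "m \<noteq> n"
        then have "A (s m) \<inter> A (s n) = {}"
          using disj strict_mono_eq[OF s] by (simp add: disjoint_family_on_def)
        then show "Pair (e j) -` A (s m) \<inter> Pair (e j) -` A (s n) = {}" by blast
      qed
      moreover have "finite (Pair (e j) -` A (s n))" for n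
        using fin by (intro finite_vimageI) (auto simp: inj_on_def)
      moreover have "property_kappa (X (e j))"
        using True \<open>J \<subseteq> I\<close> kappa by blast
      ultimately obtain r :: "nat \<Rightarrow> nat" where r: "strict_mono r"
        "strongly_point_finite (X (e j)) (\<lambda>n. Pair (e j) -` A (s (r n))) UNIV"
        using property_kappaE[of "X (e j)" "\<lambda>n. Pair (e j) -` A (s n)", OF _ _ top] by blast
      then have "Q (e j) (s \<circ> r)"
        by (simp add: Q_def)
      with r(1) show ?thesis by blast
    qed (auto intro: exI[of _ id] simp: strict_mono_def)
  qed
  have "Q i diagseq" if "i \<in> I" for i
  proof (cases "i \<in> J")
    case True
    then obtain j where j: "e j = i"
      using from_nat_into_surj[OF \<open>countable J\<close>] unfolding e_def by blast
    \<comment> \<open>The tail of the diagonal sequence from \<open>Suc j\<close> on is a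
      subsequence of the one chosen at stage \<open>j\<close>; the missing initial terms are
      restored by \<open>strongly_point_finite_offset\<close>.\<close>
    have "e j \<in> J \<longrightarrow> Q (e j) (diagseq \<circ> (+) (Suc j))"
    proof (rule diagseq_holds, intro impI)
      fix r s :: "nat \<Rightarrow> nat" and n assume "strict_mono r" "e n \<in> J \<longrightarrow> Q (e n) s" "e n \<in> J"
      then show "Q (e n) (s \<circ> r)"
        using strongly_point_finite_subseq[of "X (e n)" "\<lambda>k. Pair (e n) -` A (s k)" r]
        by (simp add: Q_def o_def)
    qed
    then show ?thesis
      using True strongly_point_finite_offset[OF top, of i diagseq "Suc j"]
      by (simp add: Q_def o_def j)
  next
    case False
    then have "Pair i -` A n = {}" for n
      by (force simp: J_def)
    then show ?thesis
      by (auto simp: Q_def strongly_point_finite_def intro!: exI[of _ "\<lambda>_. {}"])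
  qed
  then have "\<forall>i\<in>I. \<exists>U. (\<forall>n. openin (X i) (U n) \<and> Pair i -` A (diagseq n) \<subseteq> U n) \<and>
      (\<forall>x\<in>topspace (X i). finite {n. x \<in> U n})"
    by (auto simp: Q_def strongly_point_finite_def)
  from bchoice[OF this] obtain U
    where U: "\<forall>i\<in>I. (\<forall>n. openin (X i) (U i n) \<and> Pair i -` A (diagseq n) \<subseteq> U i n) \<and>
      (\<forall>x\<in>topspace (X i). finite {n. x \<in> U i n})" ..
  have "strongly_point_finite (sum_topology X I) (A \<circ> diagseq) UNIV"
    unfolding strongly_point_finite_def
  proof (intro exI[of _ "\<lambda>n. Sigma I (\<lambda>i. U i n)"] conjI ballI)
    fix n
    show "openin (sum_topology X I) (Sigma I (\<lambda>i. U i n))"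
      using U by (simp add: openin_disjoint_union)
    show "(A \<circ> diagseq) n \<subseteq> Sigma I (\<lambda>i. U i n)"
      using U sub[of "diagseq n"] by fastforce
  qed (use U in auto)
  then show "\<exists>r::nat \<Rightarrow> nat. strict_mono r \<and> strongly_point_finite (sum_topology X I) (A \<circ> r) UNIV"
    using subseq_diagseq by blast
qed

section \<open>Metrizable and locally convex spaces\<close>

text \<open>A non-compact metrizable space has a sequence \<open>z\<close> without convergent
  subsequences, and \<open>g n\<close> is a bump around \<open>z n\<close> with radius tending to
  zero. If infinitely many bumps were nonzero somewhere on a compact \<open>C\<close>, nearby points
  of \<open>C\<close> would have a convergent subsequence, and \<open>z\<close> would have one as
  well.\<close>

lemma metrizable_noncompact_bumps:
  assumes "metrizable_space Y" "\<not> compact_space Y"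
  obtains z :: "nat \<Rightarrow> 'a" and g :: "nat \<Rightarrow> 'a \<Rightarrow> real"
  where "\<And>n. continuous_map Y euclideanreal (g n)" "\<And>n. g n (z n) = 1"
    "\<And>C. compactin Y C \<Longrightarrow> finite {n. \<exists>y\<in>C. g n y \<noteq> 0}"
proof -
  obtain M d where "Metric_space M d" and Y: "Y = Metric_space.mtopology M d"
    using assms(1) unfolding metrizable_space_def by metis
  then interpret Metric_space M d by blast
  obtain z :: "nat \<Rightarrow> 'a" where z: "range z \<subseteq> M"
    and div: "\<And>l r. strict_mono r \<Longrightarrow> \<not> limitin mtopology (z \<circ> r) l sequentially"
    using assms(2) unfolding Y compact_space_sequentially by (metis limitin_mspace)
  \<comment> \<open>\<open>g n\<close> vanishes at distance at least \<open>1 / real (Suc n)\<close>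
    from \<open>z n\<close>.\<close>
  define g where "g = (\<lambda>n y. max 0 (1 - real (Suc n) * d (z n) y))"
  have zM: "z n \<in> M" for n using z by blast
  show thesis
  proof (rule that)
    show "g n (z n) = 1" for n using zM by (simp add: g_def)
    show "continuous_map Y euclideanreal (g n)" for n
    proof -
      have "continuous_map mtopology euclideanreal (\<lambda>y. d (z n) y)"
        using continuous_map_mdist[of mtopology "metric (M,d)" "\<lambda>_. z n" "\<lambda>y. y"] zM
        by (simp add: mtopology_of)
      then show ?thesis
        unfolding g_def Y by (intro continuous_intros)
    qed
    fix C assume "compactin Y C"
    show "finite {n. \<exists>y\<in>C. g n y \<noteq> 0}"
    proof (rule ccontr)
      assume inf: "infinite {n. \<exists>y\<in>C. g n y \<noteq> 0}"
      define r where "r = enumerate {n. \<exists>y\<in>C. g n y \<noteq> 0}"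
      have r: "strict_mono r"
        unfolding r_def using strict_mono_enumerate[OF inf] .
      have "\<exists>y\<in>C. g (r k) y \<noteq> 0" for k
        using enumerate_in_set[OF inf, of k] by (simp add: r_def)
      then obtain c where c: "\<And>k. c k \<in> C" "\<And>k. g (r k) (c k) \<noteq> 0"
        by metis
      have CM: "C \<subseteq> M"
        using \<open>compactin Y C\<close> compactin_subset_topspace by (fastforce simp: Y)
      have near: "d (z (r k)) (c k) < 1 / real (Suc k)" for k
      proof -
        have "real (Suc (r k)) * d (z (r k)) (c k) < 1"
          using c(2)[of k] by (auto simp: g_def max_def split: if_splits)
        moreover have "real (Suc k) * d (z (r k)) (c k) \<le> real (Suc (r k)) * d (z (r k)) (c k)"
          using strict_mono_imp_increasing[OF r, of k] by (intro mult_right_mono) auto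
        ultimately show ?thesis by (simp add: field_simps)
      qed
      obtain l q where q: "l \<in> C" "strict_mono q" "limitin mtopology (c \<circ> q) l sequentially"
        using \<open>compactin Y C\<close> c(1) unfolding Y compactin_sequentially by (metis image_subsetI)
      have "limitin mtopology (z \<circ> (r \<circ> q)) l sequentially"
        unfolding limit_metric_sequentially
      proof (intro conjI allI impI)
        show "l \<in> M" using q CM by blast
        fix e :: real assume "e > 0"
        obtain N1 where N1: "\<And>n. n \<ge> N1 \<Longrightarrow> d (c (q n)) l < e/2"
          using q(3) half_gt_zero[OF \<open>e > 0\<close>] unfolding limit_metric_sequentially o_def by blast
        obtain N2 where N2: "1 / real (Suc N2) < e/2"
          using \<open>e > 0\<close> nat_approx_posE[of "e/2"] by auto
        have "d (z (r (q n))) l < e" if "n \<ge> max N1 N2" for n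
        proof -
          have "n \<le> q n" by (rule strict_mono_imp_increasing[OF q(2)])
          then have "1 / real (Suc (q n)) \<le> 1 / real (Suc N2)"
            using that by (intro divide_left_mono) auto
          then have "d (z (r (q n))) (c (q n)) < e/2"
            using near[of "q n"] N2 by linarith
          moreover have "d (z (r (q n))) l \<le> d (z (r (q n))) (c (q n)) + d (c (q n)) l"
            using zM c(1) CM \<open>l \<in> M\<close> by (intro triangle) auto
          ultimately show ?thesis using N1[of n] that by auto
        qed
        then show "\<exists>N. \<forall>n\<ge>N. (z \<circ> (r \<circ> q)) n \<in> M \<and> d ((z \<circ> (r \<circ> q)) n) l < e"
          using zM by (intro exI[of _ "max N1 N2"]) auto
      qed
      then show False
        using div[OF strict_mono_o[OF r q(2)]] by blast
    qed
  qed
qed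

section \<open>Convexity and non-compactness in locally convex spaces\<close>

context
  fixes Y :: "'b::real_vector topology"
  assumes lcs: "locally_convex_space Y"
begin

lemma topspace_lcs: "topspace Y = UNIV"
  using lcs by (simp add: locally_convex_space_def)

lemma continuous_map_lcs_add:
  assumes "continuous_map T Y f" "continuous_map T Y g"
  shows "continuous_map T Y (\<lambda>x. f x + g x)"
proof -
  have "continuous_map (prod_topology Y Y) Y (\<lambda>(x, y). x + y)"
    using lcs by (simp add: locally_convex_space_def)
  from continuous_map_compose[OF continuous_map_pairedI[OF assms] this]
  show ?thesis by (simp add: o_def)
qed

lemma continuous_map_lcs_scale:
  assumes "continuous_map T euclideanreal c" "continuous_map T Y f"
  shows "continuous_map T Y (\<lambda>x. c x *\<^sub>R f x)"
proof -
  have "continuous_map (prod_topology euclideanreal Y) Y (\<lambda>(c, x). c *\<^sub>R x)"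
    using lcs by (simp add: locally_convex_space_def)
  from continuous_map_compose[OF continuous_map_pairedI[OF assms] this]
  show ?thesis by (simp add: o_def)
qed

lemma continuous_map_lcs_blend:
  assumes "continuous_map T euclideanreal c" "continuous_map T Y f" "continuous_map T Y g"
  shows "continuous_map T Y (\<lambda>x. (1 - c x) *\<^sub>R f x + c x *\<^sub>R g x)"
  using assms by (intro continuous_map_lcs_add continuous_map_lcs_scale continuous_intros) auto

text \<open>Translations are homeomorphisms and move a convex neighbourhood of zero to one of
  \<open>y\<close>.\<close>

lemma lcs_convex_nhd:
  assumes "openin Y U" "y \<in> U"
  obtains V where "openin Y V" "y \<in> V" "convex V" "V \<subseteq> U"
proof -
  have const: "continuous_map Y Y (\<lambda>_. c)" for c
    by (simp add: topspace_lcs)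
  have shift: "openin Y {x. c + x \<in> W}" if "openin Y W" for c W
    using openin_continuous_map_preimage[OF continuous_map_lcs_add[OF const continuous_map_id[unfolded id_def]] that]
    by (simp add: topspace_lcs)
  obtain V where V: "openin Y V" "0 \<in> V" "convex V" "V \<subseteq> {x. y + x \<in> U}"
    using lcs shift[OF assms(1), of y] assms(2) unfolding locally_convex_space_def
    by (metis (no_types, lifting) add.right_neutral mem_Collect_eq)
  have eq: "{x. - y + x \<in> V} = (+) y ` V"
    by (auto simp: image_iff intro!: bexI[of _ "- y + _"])
  show thesis
  proof (rule that)
    show "openin Y ((+) y ` V)" using shift[OF V(1), of "- y"] eq by simp
    show "convex ((+) y ` V)" using V(3) by (rule convex_translation)
  qed (use V in auto)
qed

text \<open>A convex neighbourhood of \<open>y\<close> that contains \<open>g n\<close> contains the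
  whole segment between them, so the weights \<open>t n\<close> may vary arbitrarily in the unit
  interval.\<close>

lemma limitin_lcs_blend:
  assumes "limitin Y g y F" and t: "\<And>n. t n \<in> {0..1}"
  shows "limitin Y (\<lambda>n. (1 - t n) *\<^sub>R y + t n *\<^sub>R g n) y F"
  unfolding limitin_def
proof (intro conjI allI impI)
  show "y \<in> topspace Y" by (simp add: topspace_lcs)
  fix U assume "openin Y U \<and> y \<in> U"
  then obtain V where V: "openin Y V" "y \<in> V" "convex V" "V \<subseteq> U"
    using lcs_convex_nhd by blast
  show "\<forall>\<^sub>F n in F. (1 - t n) *\<^sub>R y + t n *\<^sub>R g n \<in> U"
    using limitinD[OF assms(1) V(1,2)]
  proof (rule eventually_mono)
    fix n assume "g n \<in> V"
    then have "(1 - t n) *\<^sub>R y + t n *\<^sub>R g n \<in> V"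
      using V t[of n] by (intro convexD) auto
    then show "(1 - t n) *\<^sub>R y + t n *\<^sub>R g n \<in> U"
      using V(4) by blast
  qed
qed

text \<open>If a subsequence of the multiples of \<open>y\<close> by natural numbers converged,
  multiplying it by the scalars \<open>1 / real (r n)\<close>, which tend to zero, would make the
  constant sequence \<open>y\<close> converge to zero.\<close>

lemma lcs_not_compact_space:
  assumes "metrizable_space Y" "y \<noteq> (0::'b)"
  shows "\<not> compact_space Y"
proof
  assume comp: "compact_space Y"
  obtain M d where "Metric_space M d" and Y: "Y = Metric_space.mtopology M d"
    using assms(1) unfolding metrizable_space_def by metis
  then interpret Metric_space M d by blast
  have "range (\<lambda>n. real n *\<^sub>R y) \<subseteq> M"
    using topspace_lcs by (simp add: Y)
  then obtain l r where r: "strict_mono r" "limitin Y ((\<lambda>n. real n *\<^sub>R y) \<circ> r) l sequentially"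
    using comp unfolding Y compact_space_sequentially by blast
  have "(\<lambda>n. 1 / real (r n)) \<longlonglongrightarrow> 0"
    using LIMSEQ_subseq_LIMSEQ[OF lim_1_over_n r(1)] by (simp add: o_def)
  then have "limitin (prod_topology euclideanreal Y) (\<lambda>n. (1 / real (r n), real (r n) *\<^sub>R y)) (0, l) sequentially"
    using r(2) by (simp add: limitin_pairwise o_def)
  moreover have "continuous_map (prod_topology euclideanreal Y) Y (\<lambda>(c, x). c *\<^sub>R x)"
    using lcs by (simp add: locally_convex_space_def)
  ultimately have "limitin Y (\<lambda>n. (1 / real (r n)) *\<^sub>R (real (r n) *\<^sub>R y)) 0 sequentially"
    by (auto dest!: continuous_map_limit simp: o_def)
  \<comment> \<open>The index \<open>0\<close> is left out because \<open>r 0\<close> may be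
    \<open>0\<close>, and then \<open>1 / real (r 0)\<close> is \<open>0\<close>.\<close>
  moreover have "\<forall>\<^sub>F n in sequentially. (1 / real (r n)) *\<^sub>R (real (r n) *\<^sub>R y) = y"
    unfolding eventually_sequentially
  proof (intro exI[of _ 1] allI impI)
    fix n :: nat assume "n \<ge> 1"
    then have "r n \<noteq> 0" using strict_mono_imp_increasing[OF r(1), of n] by auto
    then show "(1 / real (r n)) *\<^sub>R (real (r n) *\<^sub>R y) = y" by simp
  qed
  ultimately have zero: "limitin Y (\<lambda>n::nat. y) 0 sequentially"
    by (rule limitin_transform_eventually[rotated])
  have "limitin Y (\<lambda>n::nat. y) y sequentially"
    by (simp add: topspace_lcs)
  from limitin_Hausdorff_unique[OF this zero trivial_limit_sequentially
      metrizable_imp_Hausdorff_space[OF assms(1)]]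
  show False using assms(2) by simp
qed

end

section \<open>Spaces of continuous functions\<close>

text \<open>Serves to replace \<open>g\<close> by \<open>f\<close> away from prescribed points,
  keeping the values of \<open>g\<close> at those points and staying in the function space; the
  restriction makes the result an extensional representative.\<close>

definition blend :: "'a topology \<Rightarrow> ('a \<Rightarrow> real) \<Rightarrow> ('a \<Rightarrow> 'b) \<Rightarrow> ('a \<Rightarrow> 'b) \<Rightarrow> 'a \<Rightarrow> 'b::real_vector" where
  "blend X \<phi> f g = (\<lambda>x\<in>topspace X. (1 - \<phi> x) *\<^sub>R f x + \<phi> x *\<^sub>R g x)"

text \<open>The only property of the three function spaces that matters: it is shared by all of them.\<close>

definition blend_closed :: "'a topology \<Rightarrow> 'b::real_vector topology \<Rightarrow> ('a \<Rightarrow> 'b) set \<Rightarrow> bool" where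
  "blend_closed X Y S \<longleftrightarrow> S \<subseteq> cont_maps X Y \<and> (\<forall>c. (\<lambda>x\<in>topspace X. c) \<in> S) \<and>
     (\<forall>f\<in>S. \<forall>g\<in>S. \<forall>\<phi>. continuous_map X (top_of_set {0..1}) \<phi> \<longrightarrow> blend X \<phi> f g \<in> S)"

lemma blend_closed_subset:
  "blend_closed X Y S \<Longrightarrow> S \<subseteq> cont_maps X Y"
  and blend_closed_const: "blend_closed X Y S \<Longrightarrow> (\<lambda>x\<in>topspace X. c) \<in> S"
  and blend_closed_blend: "blend_closed X Y S \<Longrightarrow> f \<in> S \<Longrightarrow> g \<in> S \<Longrightarrow>
    continuous_map X (top_of_set {0..1}) \<phi> \<Longrightarrow> blend X \<phi> f g \<in> S"
  unfolding blend_closed_def by blast+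

abbreviation pointwise_top :: "'a topology \<Rightarrow> 'b topology \<Rightarrow> ('a \<Rightarrow> 'b) set \<Rightarrow> ('a \<Rightarrow> 'b) topology" where
  "pointwise_top X Y S \<equiv> subtopology (product_topology (\<lambda>_. Y) (topspace X)) S"

lemma Cpb_eq: "Cpb X Y = pointwise_top X Y (cont_maps X Y \<inter> {f. bounded_in Y (f ` topspace X)})"
  by (simp add: Cpb_def Cp_def subtopology_subtopology)

lemma Cprc_eq: "Cprc X Y = pointwise_top X Y (cont_maps X Y \<inter> {f. relatively_compact_in Y (f ` topspace X)})"
  by (simp add: Cprc_def Cp_def subtopology_subtopology)

section \<open>Boundedness and relative compactness under blending\<close>

text \<open>By continuity at zero, small multiples of \<open>c\<close> lie in \<open>U\<close>; this
  puts the constant functions into \<open>Cpb\<close>.\<close>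

lemma bounded_in_singleton:
  assumes "locally_convex_space Y"
  shows "bounded_in Y {c}"
  unfolding bounded_in_def
proof (intro allI impI)
  fix U assume U: "openin Y U \<and> 0 \<in> U"
  have "continuous_map euclideanreal Y (\<lambda>s. s *\<^sub>R c)"
    by (intro continuous_map_lcs_scale[OF assms]) (auto simp: topspace_lcs[OF assms])
  then have "open {s. s *\<^sub>R c \<in> U}"
    using openin_continuous_map_preimage U by fastforce
  moreover have "0 \<in> {s. s *\<^sub>R c \<in> U}" using U by simp
  ultimately obtain e where "e > 0" and "\<forall>s. dist s 0 < e \<longrightarrow> s \<in> {s. s *\<^sub>R c \<in> U}"
    unfolding open_dist by blast
  then have e: "s *\<^sub>R c \<in> U" if "\<bar>s\<bar> < e" for s
    using that by simp
  show "\<exists>r>0. \<forall>t. \<bar>t\<bar> \<ge> r \<longrightarrow> {c} \<subseteq> (\<lambda>u. t *\<^sub>R u) ` U"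
  \<comment> \<open>The factor 2 turns \<open>\<bar>t\<bar> \<ge> 2 / e\<close> into the strict
    bound \<open>\<bar>1 / t\<bar> < e\<close>.\<close>
  proof (intro exI[of _ "2 / e"] conjI allI impI)
    show "2 / e > 0" using \<open>e > 0\<close> by simp
    fix t :: real assume t: "\<bar>t\<bar> \<ge> 2 / e"
    then have "t \<noteq> 0" using \<open>2 / e > 0\<close> by auto
    have "\<bar>1 / t\<bar> < e"
      using t \<open>e > 0\<close> \<open>t \<noteq> 0\<close> by (simp add: field_simps)
    then have "(1 / t) *\<^sub>R c \<in> U" by (rule e)
    moreover have "c = t *\<^sub>R ((1 / t) *\<^sub>R c)" using \<open>t \<noteq> 0\<close> by simp
    ultimately show "{c} \<subseteq> (\<lambda>u. t *\<^sub>R u) ` U" by blast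
  qed
qed

lemma bounded_in_subset: "bounded_in Y B \<Longrightarrow> A \<subseteq> B \<Longrightarrow> bounded_in Y A"
  unfolding bounded_in_def by (meson order_trans)

text \<open>The dilate by \<open>p\<close> of a convex neighbourhood \<open>V\<close> is convex and,
  once \<open>\<bar>p\<bar>\<close> is large, contains both \<open>B\<close> and \<open>C\<close>,
  hence all segments between them.\<close>

lemma bounded_in_blend:
  assumes Y: "locally_convex_space Y" and "bounded_in Y B" "bounded_in Y C"
  shows "bounded_in Y {(1 - t) *\<^sub>R b + t *\<^sub>R c | t b c. t \<in> {0..1} \<and> b \<in> B \<and> c \<in> C}"
  unfolding bounded_in_def
proof (intro allI impI)
  fix U assume U: "openin Y U \<and> 0 \<in> U"
  then obtain V where V: "openin Y V" "0 \<in> V" "convex V" "V \<subseteq> U"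
    using lcs_convex_nhd[OF Y] by blast
  obtain r where r: "r > 0" "\<And>t. \<bar>t\<bar> \<ge> r \<Longrightarrow> B \<subseteq> (\<lambda>u. t *\<^sub>R u) ` V"
    using assms(2) V(1,2) unfolding bounded_in_def by meson
  obtain s where s: "s > 0" "\<And>t. \<bar>t\<bar> \<ge> s \<Longrightarrow> C \<subseteq> (\<lambda>u. t *\<^sub>R u) ` V"
    using assms(3) V(1,2) unfolding bounded_in_def by meson
  show "\<exists>r>0. \<forall>t. \<bar>t\<bar> \<ge> r \<longrightarrow>
      {(1 - t) *\<^sub>R b + t *\<^sub>R c | t b c. t \<in> {0..1} \<and> b \<in> B \<and> c \<in> C} \<subseteq> (\<lambda>u. t *\<^sub>R u) ` U"
  proof (intro exI[of _ "max r s"] conjI allI impI)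
    fix p :: real assume p: "\<bar>p\<bar> \<ge> max r s"
    have "convex ((\<lambda>u. p *\<^sub>R u) ` V)"
      using V(3) by (rule convex_scaling)
    moreover have "B \<subseteq> (\<lambda>u. p *\<^sub>R u) ` V" "C \<subseteq> (\<lambda>u. p *\<^sub>R u) ` V"
      using r(2) s(2) p by auto
    ultimately have "(1 - t) *\<^sub>R b + t *\<^sub>R c \<in> (\<lambda>u. p *\<^sub>R u) ` V"
      if "t \<in> {0..1}" "b \<in> B" "c \<in> C" for t b c
      using that by (intro convexD) auto
    then show "{(1 - t) *\<^sub>R b + t *\<^sub>R c | t b c. t \<in> {0..1} \<and> b \<in> B \<and> c \<in> C} \<subseteq> (\<lambda>u. p *\<^sub>R u) ` U"
      using V(4) by blast
  qed (use r(1) in auto)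
qed

text \<open>In a Hausdorff space \<open>K\<close> is closed, so the closure of \<open>B\<close> is a
  closed subset of \<open>K\<close>.\<close>

lemma relatively_compact_in_subset:
  assumes "Hausdorff_space Y" "compactin Y K" "B \<subseteq> K"
  shows "relatively_compact_in Y B"
  unfolding relatively_compact_in_def
proof (rule closed_compactin)
  show "Y closure_of B \<subseteq> K"
    using assms by (simp add: closure_of_minimal compactin_imp_closedin)
qed (use assms in auto)

lemma compactin_blend:
  assumes Y: "locally_convex_space Y" and "compactin Y K" "compactin Y L"
  shows "compactin Y {(1 - t) *\<^sub>R b + t *\<^sub>R c | t b c. t \<in> {0..1} \<and> b \<in> K \<and> c \<in> L}"
proof -
  let ?P = "prod_topology euclideanreal (prod_topology Y Y)"
  have "continuous_map ?P Y (\<lambda>p. (1 - fst p) *\<^sub>R fst (snd p) + fst p *\<^sub>R snd (snd p))"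
    by (intro continuous_map_lcs_blend[OF Y] continuous_map_fst continuous_map_fst_of
        continuous_map_compose[OF continuous_map_snd, unfolded o_def] continuous_map_snd)
  moreover have "compactin ?P ({0..1} \<times> K \<times> L)"
    using assms by (simp add: compactin_Times)
  ultimately have "compactin Y ((\<lambda>p. (1 - fst p) *\<^sub>R fst (snd p) + fst p *\<^sub>R snd (snd p)) ` ({0..1} \<times> K \<times> L))"
    by (rule image_compactin[rotated])
  moreover have "(\<lambda>p. (1 - fst p) *\<^sub>R fst (snd p) + fst p *\<^sub>R snd (snd p)) ` ({0..1} \<times> K \<times> L) =
      {(1 - t) *\<^sub>R b + t *\<^sub>R c | t b c. t \<in> {0..1} \<and> b \<in> K \<and> c \<in> L}"
    by force
  ultimately show ?thesis by simp
qed

lemma blend_image_subset: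
  assumes "continuous_map X (top_of_set {0..1}) \<phi>" "f ` topspace X \<subseteq> B" "g ` topspace X \<subseteq> C"
  shows "blend X \<phi> f g ` topspace X \<subseteq>
    {(1 - t) *\<^sub>R b + t *\<^sub>R c | t b c. t \<in> {0..1} \<and> b \<in> B \<and> c \<in> C}"
proof (rule image_subsetI)
  fix x assume x: "x \<in> topspace X"
  then have "\<phi> x \<in> {0..1}"
    using continuous_map_image_subset_topspace[OF assms(1)] by auto
  then show "blend X \<phi> f g x \<in> {(1 - t) *\<^sub>R b + t *\<^sub>R c | t b c. t \<in> {0..1} \<and> b \<in> B \<and> c \<in> C}"
    using assms(2,3) x by (force simp: blend_def)
qed

lemma blend_closed_cont_maps:
  assumes "locally_convex_space Y"
  shows "blend_closed X Y (cont_maps X Y)"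
  unfolding blend_closed_def
proof (intro conjI allI ballI impI subset_refl)
  fix c
  have "continuous_map X Y (\<lambda>x. c)"
    by (simp add: topspace_lcs[OF assms])
  then show "(\<lambda>x\<in>topspace X. c) \<in> cont_maps X Y"
    by (auto simp: cont_maps_def intro: continuous_map_eq)
next
  fix f g \<phi>
  assume "f \<in> cont_maps X Y" "g \<in> cont_maps X Y" "continuous_map X (top_of_set {0..1::real}) \<phi>"
  then have "continuous_map X Y (\<lambda>x. (1 - \<phi> x) *\<^sub>R f x + \<phi> x *\<^sub>R g x)"
    by (intro continuous_map_lcs_blend[OF assms]) (auto simp: cont_maps_def continuous_map_in_subtopology)
  then show "blend X \<phi> f g \<in> cont_maps X Y"
    by (auto simp: cont_maps_def blend_def intro: continuous_map_eq)
qed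

lemma blend_closed_bounded:
  assumes Y: "locally_convex_space Y"
  shows "blend_closed X Y (cont_maps X Y \<inter> {f. bounded_in Y (f ` topspace X)})"
  unfolding blend_closed_def
proof (intro conjI allI ballI impI)
  fix c
  have "bounded_in Y ((\<lambda>x\<in>topspace X. c) ` topspace X)"
    by (rule bounded_in_subset[OF bounded_in_singleton[OF Y, of c]]) auto
  then show "(\<lambda>x\<in>topspace X. c) \<in> cont_maps X Y \<inter> {f. bounded_in Y (f ` topspace X)}"
    using blend_closed_const[OF blend_closed_cont_maps[OF Y]] by blast
next
  fix f g \<phi>
  assume f: "f \<in> cont_maps X Y \<inter> {f. bounded_in Y (f ` topspace X)}"
    and g: "g \<in> cont_maps X Y \<inter> {f. bounded_in Y (f ` topspace X)}"
    and \<phi>: "continuous_map X (top_of_set {0..1::real}) \<phi>"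
  have "bounded_in Y (blend X \<phi> f g ` topspace X)"
    using bounded_in_subset[OF bounded_in_blend[OF Y] blend_image_subset[OF \<phi> subset_refl subset_refl]] f g
    by blast
  then show "blend X \<phi> f g \<in> cont_maps X Y \<inter> {f. bounded_in Y (f ` topspace X)}"
    using blend_closed_blend[OF blend_closed_cont_maps[OF Y] _ _ \<phi>] f g by blast
qed auto

text \<open>A blend takes its values on segments between the compact closures of the two images, and
  these segments fill a compact set.\<close>

lemma blend_closed_relatively_compact:
  assumes Y: "locally_convex_space Y" and "Hausdorff_space Y"
  shows "blend_closed X Y (cont_maps X Y \<inter> {f. relatively_compact_in Y (f ` topspace X)})"
  unfolding blend_closed_def
proof (intro conjI allI ballI impI)
  fix c
  have "relatively_compact_in Y ((\<lambda>x\<in>topspace X. c) ` topspace X)"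
    by (rule relatively_compact_in_subset[OF assms(2), of "{c}"]) (auto simp: topspace_lcs[OF Y])
  then show "(\<lambda>x\<in>topspace X. c) \<in> cont_maps X Y \<inter> {f. relatively_compact_in Y (f ` topspace X)}"
    using blend_closed_const[OF blend_closed_cont_maps[OF Y]] by blast
next
  fix f g \<phi>
  assume f: "f \<in> cont_maps X Y \<inter> {f. relatively_compact_in Y (f ` topspace X)}"
    and g: "g \<in> cont_maps X Y \<inter> {f. relatively_compact_in Y (f ` topspace X)}"
    and \<phi>: "continuous_map X (top_of_set {0..1::real}) \<phi>"
  have "h ` topspace X \<subseteq> Y closure_of (h ` topspace X)" for h
    by (simp add: closure_of_subset topspace_lcs[OF Y])
  note sub = this
  have "compactin Y (Y closure_of (f ` topspace X))" "compactin Y (Y closure_of (g ` topspace X))"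
    using f g by (simp_all add: relatively_compact_in_def)
  from relatively_compact_in_subset[OF assms(2) compactin_blend[OF Y this] blend_image_subset[OF \<phi> sub sub]]
  have "relatively_compact_in Y (blend X \<phi> f g ` topspace X)" .
  then show "blend X \<phi> f g \<in> cont_maps X Y \<inter> {f. relatively_compact_in Y (f ` topspace X)}"
    using blend_closed_blend[OF blend_closed_cont_maps[OF Y] _ _ \<phi>] f g by blast
qed auto

text \<open>For each \<open>a\<close> in \<open>D\<close> some \<open>u a\<close> vanishes at
  \<open>a\<close> and is one off \<open>V\<close>; one minus the finite product of these functions
  is the required \<phi>.\<close>

lemma completely_regular_space_finite_openin:
  assumes "completely_regular_space X" "finite D" "D \<subseteq> V" "openin X V"
  obtains \<phi> :: "'a \<Rightarrow> real" where "continuous_map X (top_of_set {0..1}) \<phi>"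
    "\<And>x. x \<in> D \<Longrightarrow> \<phi> x = 1" "\<And>x. x \<in> topspace X - V \<Longrightarrow> \<phi> x = 0"
proof -
  have "\<exists>u. continuous_map X (top_of_set {0..1::real}) u \<and> u a = 0 \<and> u ` (topspace X - V) \<subseteq> {1}"
    if "a \<in> D" for a
  proof -
    have "closedin X (topspace X - V)" "a \<in> topspace X - (topspace X - V)"
      using that assms openin_subset by auto
    then show ?thesis
      using assms(1) unfolding completely_regular_space_def by blast
  qed
  then obtain u where u: "\<And>a. a \<in> D \<Longrightarrow> continuous_map X (top_of_set {0..1::real}) (u a)"
    "\<And>a. a \<in> D \<Longrightarrow> u a a = 0" "\<And>a. a \<in> D \<Longrightarrow> u a ` (topspace X - V) \<subseteq> {1}"
    by metis
  define \<phi> where "\<phi> = (\<lambda>x. 1 - (\<Prod>a\<in>D. u a x))"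
  have u01: "u a x \<in> {0..1}" if "a \<in> D" "x \<in> topspace X" for a x
    using continuous_map_image_subset_topspace[OF u(1)[OF that(1)]] that(2) by auto
  have "continuous_map X euclideanreal \<phi>"
    unfolding \<phi>_def using u(1) assms(2)
    by (intro continuous_intros) (auto simp: continuous_map_in_subtopology)
  moreover have "\<phi> x \<in> {0..1}" if "x \<in> topspace X" for x
    using u01 that by (auto simp: \<phi>_def prod_nonneg intro!: prod_le_1)
  ultimately have "continuous_map X (top_of_set {0..1}) \<phi>"
    by (auto simp: continuous_map_in_subtopology)
  moreover have "\<phi> x = 1" if "x \<in> D" for x
    using that u(2) assms(2) by (auto simp: \<phi>_def intro: prod_zero)
  moreover have "\<phi> x = 0" if "x \<in> topspace X - V" for x
  proof -
    have "u a x = 1" if "a \<in> D" for a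
      using u(3)[OF that] \<open>x \<in> topspace X - V\<close> by blast
    then show ?thesis by (simp add: \<phi>_def)
  qed
  ultimately show thesis by (rule that)
qed

section \<open>Finite determination in the pointwise topology and its powers\<close>

lemma topspace_pointwise_top:
  assumes "S \<subseteq> cont_maps X Y"
  shows "topspace (pointwise_top X Y S) = S"
proof -
  have "cont_maps X Y \<subseteq> (\<Pi>\<^sub>E x\<in>topspace X. topspace Y)"
    by (auto simp: cont_maps_def PiE_iff extensional_def dest: continuous_map_image_subset_topspace)
  then have "S \<subseteq> (\<Pi>\<^sub>E x\<in>topspace X. topspace Y)"
    using assms by (rule subset_trans[rotated])
  then show ?thesis
    by (simp only: topspace_subtopology topspace_product_topology inf.absorb2)
qed

lemma continuous_map_pointwise_eval:
  assumes "x \<in> topspace X"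
  shows "continuous_map (pointwise_top X Y S) Y (\<lambda>h. h x)"
  using assms by (intro continuous_map_from_subtopology continuous_map_product_projection)

text \<open>A basic open box around \<open>h\<close> constrains only finitely many coordinates; a
  function of the space that agrees with \<open>h\<close> at these stays in the box.\<close>

lemma openin_pointwise_finite:
  assumes "openin (pointwise_top X Y S) U" "h \<in> U"
  obtains F where "finite F" "F \<subseteq> topspace X"
    "\<And>h'. h' \<in> topspace (pointwise_top X Y S) \<Longrightarrow> (\<And>x. x \<in> F \<Longrightarrow> h' x = h x) \<Longrightarrow> h' \<in> U"
proof -
  obtain W where W: "openin (product_topology (\<lambda>_. Y) (topspace X)) W" "U = W \<inter> S"
    using assms(1) unfolding openin_subtopology by blast
  then have "h \<in> W" using assms(2) by blast
  from product_topology_open_contains_basis[OF W(1) this] obtain O' where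
    O': "h \<in> (\<Pi>\<^sub>E x\<in>topspace X. O' x)" "finite {x. O' x \<noteq> topspace Y}"
      "(\<Pi>\<^sub>E x\<in>topspace X. O' x) \<subseteq> W"
    by blast
  show thesis
  proof (rule that[of "{x. O' x \<noteq> topspace Y} \<inter> topspace X"])
    fix h' assume h': "h' \<in> topspace (pointwise_top X Y S)"
      "\<And>x. x \<in> {x. O' x \<noteq> topspace Y} \<inter> topspace X \<Longrightarrow> h' x = h x"
    have "h' \<in> (\<Pi>\<^sub>E x\<in>topspace X. O' x)"
    proof (rule PiE_I)
      fix x assume "x \<in> topspace X"
      then show "h' x \<in> O' x"
        using h' O'(1) by (cases "O' x = topspace Y") auto
    qed (use h'(1) in auto)
    then show "h' \<in> U" using O'(3) h'(1) W(2) by auto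
  qed (use O'(2) in auto)
qed

text \<open>Finitely many factors are constrained, each through finitely many points of
  \<open>X\<close>. Recording pairs \<open>(i, x)\<close> turns this into one finite subset of a
  disjoint sum of copies of \<open>X\<close>.\<close>

lemma openin_power_pointwise_finite:
  assumes "openin (power_top (pointwise_top X Y S) I) U" "h \<in> U"
  obtains F where "finite F" "F \<subseteq> I \<times> topspace X"
    "\<And>h'. h' \<in> topspace (power_top (pointwise_top X Y S) I) \<Longrightarrow>
       (\<And>i x. (i, x) \<in> F \<Longrightarrow> h' i x = h i x) \<Longrightarrow> h' \<in> U"
proof -
  let ?E = "pointwise_top X Y S"
  from product_topology_open_contains_basis[OF assms(1)[unfolded power_top_def] assms(2)]
  obtain O' where O': "h \<in> (\<Pi>\<^sub>E i\<in>I. O' i)" "\<And>i. openin ?E (O' i)" "finite {i. O' i \<noteq> topspace ?E}"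
      "(\<Pi>\<^sub>E i\<in>I. O' i) \<subseteq> U"
    by blast
  have "\<exists>F. finite F \<and> F \<subseteq> topspace X \<and>
      (\<forall>h'\<in>topspace ?E. (\<forall>x\<in>F. h' x = h i x) \<longrightarrow> h' \<in> O' i)" if "i \<in> I" for i
  proof -
    have "h i \<in> O' i" using O'(1) that by blast
    from openin_pointwise_finite[OF O'(2) this] show ?thesis by metis
  qed
  then obtain F where F: "\<And>i. i \<in> I \<Longrightarrow> finite (F i)" "\<And>i. i \<in> I \<Longrightarrow> F i \<subseteq> topspace X"
    "\<And>i h'. i \<in> I \<Longrightarrow> h' \<in> topspace ?E \<Longrightarrow> (\<forall>x\<in>F i. h' x = h i x) \<Longrightarrow> h' \<in> O' i"
    by metis
  let ?J = "{i. O' i \<noteq> topspace ?E} \<inter> I"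
  show thesis
  proof (rule that[of "Sigma ?J F"])
    fix h' assume h': "h' \<in> topspace (power_top ?E I)" "\<And>i x. (i, x) \<in> Sigma ?J F \<Longrightarrow> h' i x = h i x"
    have h'_PiE: "h' \<in> (\<Pi>\<^sub>E i\<in>I. topspace ?E)"
      using h'(1) by (simp only: power_top_def topspace_product_topology)
    have "h' \<in> (\<Pi>\<^sub>E i\<in>I. O' i)"
    proof (rule PiE_I)
      fix i assume "i \<in> I"
      with h'_PiE have "h' i \<in> topspace ?E" by (rule PiE_mem)
      then show "h' i \<in> O' i"
        using h'(2) F(3)[OF \<open>i \<in> I\<close>] \<open>i \<in> I\<close> by (cases "O' i = topspace ?E") auto
    next
      fix i assume "i \<notin> I"
      with h'_PiE show "h' i = undefined" by (rule PiE_arb)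
    qed
    then show "h' \<in> U" using O'(4) by blast
  qed (use O'(3) F in auto)
qed

lemma tychonoff_space_pointwise:
  assumes "metrizable_space Y"
  shows "tychonoff_space (pointwise_top X Y S)"
  using assms unfolding tychonoff_space_def
  by (intro conjI completely_regular_space_subtopology Hausdorff_space_subtopology)
    (simp_all add: completely_regular_space_product_topology metrizable_imp_completely_regular_space
      Hausdorff_space_product_topology metrizable_imp_Hausdorff_space)

lemma tychonoff_space_power_pointwise:
  assumes "metrizable_space Y"
  shows "tychonoff_space (power_top (pointwise_top X Y S) I)"
  using tychonoff_space_pointwise[OF assms, of X S] unfolding tychonoff_space_def power_top_def
  by (simp add: completely_regular_space_product_topology Hausdorff_space_product_topology)

section \<open>From property \<open>(\<kappa>)\<close> to powers of function spaces\<close>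

text \<open>
  Near a point \<open>f\<close> of the closure of the open set \<open>U\<close>, choose \<open>g n \<in> U\<close>, determined in \<open>U\<close> by its
  values on a finite set \<open>\<Phi> (g n)\<close>, which is close to \<open>f\<close> on the finite sets of the earlier steps.
  The points of \<open>\<Phi> (g n)\<close> that are new form a disjoint sequence. Along a strongly point-finite
  subsequence, \<open>g n\<close> can be replaced by \<open>f\<close> outside the union of the given neighbourhood of the
  new points and the region where \<open>g n\<close> is close to \<open>f\<close>.
\<close>
lemma property_kappa_imp_kappa_Frechet_Urysohn_power:
  fixes Y :: "'b::real_vector topology" and I :: "'i set"
  assumes Y: "locally_convex_space Y" "metrizable_space Y"
    and X: "completely_regular_space X" "property_kappa X"
    and S: "blend_closed X Y S"
  shows "kappa_Frechet_Urysohn (power_top (pointwise_top X Y S) I)" (is "kappa_Frechet_Urysohn ?T")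
  unfolding kappa_Frechet_Urysohn_def
proof (intro allI impI)
  fix U f assume "openin ?T U \<and> f \<in> ?T closure_of U"
  then have U: "openin ?T U" and f: "f \<in> ?T closure_of U" by auto
  obtain M d where "Metric_space M d" and Yeq: "Y = Metric_space.mtopology M d"
    using Y(2) unfolding metrizable_space_def by metis
  then interpret Metric_space M d by blast
  have M: "y \<in> M" for y using topspace_lcs[OF Y(1)] by (simp add: Yeq)
  have topT: "topspace ?T = (\<Pi>\<^sub>E i\<in>I. S)"
    using topspace_pointwise_top[OF blend_closed_subset[OF S]] by (simp add: power_top_def)
  have fT: "f \<in> topspace ?T" using f by (simp add: in_closure_of)
  have cont: "continuous_map X Y (h i)" if "h \<in> topspace ?T" "i \<in> I" for h i
    using that blend_closed_subset[OF S] unfolding topT cont_maps_def by blast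

  have "\<exists>F. finite F \<and> F \<subseteq> I \<times> topspace X \<and>
      (\<forall>h'\<in>topspace ?T. (\<forall>p\<in>F. h' (fst p) (snd p) = h (fst p) (snd p)) \<longrightarrow> h' \<in> U)"
    if "h \<in> U" for h
    by (rule openin_power_pointwise_finite[OF U that]) force
  then obtain \<Phi> where \<Phi>: "\<And>h. h \<in> U \<Longrightarrow> finite (\<Phi> h)" "\<And>h. h \<in> U \<Longrightarrow> \<Phi> h \<subseteq> I \<times> topspace X"
    "\<And>h h'. h \<in> U \<Longrightarrow> h' \<in> topspace ?T \<Longrightarrow>
      (\<And>p. p \<in> \<Phi> h \<Longrightarrow> h' (fst p) (snd p) = h (fst p) (snd p)) \<Longrightarrow> h' \<in> U"
    by metis

  \<comment> \<open>As \<open>f\<close> lies in the closure of \<open>U\<close>, members of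
    \<open>U\<close> approximate it on any finite set of pairs; \<open>\<gamma>\<close> below
    chooses such a member.\<close>
  have "\<exists>g\<in>U. \<forall>p\<in>F. d (g (fst p) (snd p)) (f (fst p) (snd p)) < e"
    if "finite F" "F \<subseteq> I \<times> topspace X" "e > 0" for F e
  proof -
    define N where "N = (\<lambda>p. {h \<in> topspace ?T. h (fst p) (snd p) \<in> mball (f (fst p) (snd p)) e})"
    have "openin ?T (N p)" if "p \<in> F" for p
    proof -
      have "fst p \<in> I" "snd p \<in> topspace X" using that \<open>F \<subseteq> I \<times> topspace X\<close> by auto
      then have "continuous_map ?T (pointwise_top X Y S) (\<lambda>h. h (fst p))"
        "continuous_map (pointwise_top X Y S) Y (\<lambda>h. h (snd p))"
        unfolding power_top_def
        by (auto intro: continuous_map_product_projection continuous_map_pointwise_eval)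
      from continuous_map_compose[OF this]
      have "continuous_map ?T Y (\<lambda>h. h (fst p) (snd p))"
        by (simp add: o_def)
      then show ?thesis
        unfolding N_def by (rule openin_continuous_map_preimage) (simp add: Yeq)
    qed
    then have "openin ?T (topspace ?T \<inter> \<Inter>(N ` F))"
      using that(1) by (cases "F = {}") (auto intro!: openin_Int openin_Inter)
    moreover have "f \<in> topspace ?T \<inter> \<Inter>(N ` F)"
      using fT \<open>e > 0\<close> by (auto simp: N_def M)
    ultimately obtain g where "g \<in> U" "g \<in> topspace ?T \<inter> \<Inter>(N ` F)"
      using f unfolding in_closure_of by blast
    then show ?thesis
      by (intro bexI[of _ g]) (auto simp: N_def M commute)
  qed
  then obtain \<gamma> where \<gamma>: "\<And>F e. finite F \<Longrightarrow> F \<subseteq> I \<times> topspace X \<Longrightarrow> e > 0 \<Longrightarrow>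
      \<gamma> F e \<in> U \<and> (\<forall>p\<in>F. d (\<gamma> F e (fst p) (snd p)) (f (fst p) (snd p)) < e)"
    by metis

  \<comment> \<open>\<open>G n\<close> collects the pairs that determine the earlier choices;
    removing it from \<open>\<Phi> (g n)\<close> makes the sets \<open>A n\<close> disjoint.\<close>
  define G where "G = rec_nat {} (\<lambda>n F. F \<union> \<Phi> (\<gamma> F (1 / real (Suc n))))"
  define g where "g = (\<lambda>n. \<gamma> (G n) (1 / real (Suc n)))"
  define A where "A = (\<lambda>n. \<Phi> (g n) - G n)"
  have G_Suc: "G (Suc n) = G n \<union> \<Phi> (g n)" for n
    by (simp add: G_def g_def)
  have G: "finite (G n) \<and> G n \<subseteq> I \<times> topspace X" for n
  proof (induction n)
    case 0
    show ?case by (simp add: G_def)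
  next
    case (Suc n)
    then have "g n \<in> U" using \<gamma> by (simp add: g_def)
    with Suc \<Phi> show ?case by (simp add: G_Suc)
  qed
  then have gU: "g n \<in> U" and g_near: "p \<in> G n \<Longrightarrow> d (g n (fst p) (snd p)) (f (fst p) (snd p)) < 1 / real (Suc n)" for n p
    using \<gamma>[of "G n" "1 / real (Suc n)"] by (auto simp: g_def)
  have gT: "g n \<in> topspace ?T" for n
    using gU openin_subset[OF U] by blast
  have G_mono: "G m \<subseteq> G n" if "m \<le> n" for m n
    using that by (rule lift_Suc_mono_le[rotated]) (simp add: G_Suc)
  have disj: "A m \<inter> A n = {}" if "m < n" for m n
  proof -
    have "A m \<subseteq> G (Suc m)" by (auto simp: A_def G_Suc)
    also have "\<dots> \<subseteq> G n" using that by (intro G_mono) simp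
    finally show ?thesis by (auto simp: A_def)
  qed
  have "disjoint_family A"
    unfolding disjoint_family_on_def using disj by (metis Int_commute nat_neq_iff)
  moreover have "finite (A n)" "A n \<subseteq> topspace (sum_topology (\<lambda>_. X) I)" for n
    using \<Phi>(1,2)[OF gU] by (auto simp: A_def)
  \<comment> \<open>The pairs are points of a disjoint sum of copies of \<open>X\<close>, so one
    strongly point-finite family serves all coordinates together.\<close>
  moreover have "property_kappa (sum_topology (\<lambda>_. X) I)"
    using X(2) by (rule property_kappa_sum_topology)
  ultimately obtain r :: "nat \<Rightarrow> nat" where r: "strict_mono r"
    and "strongly_point_finite (sum_topology (\<lambda>_. X) I) (\<lambda>n. A (r n)) UNIV"
    using property_kappaE by blast
  then obtain W where
      W': "\<forall>k\<in>UNIV. openin (sum_topology (\<lambda>_. X) I) (W k) \<and> A (r k) \<subseteq> W k"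
        "\<forall>p\<in>topspace (sum_topology (\<lambda>_. X) I). finite {k \<in> UNIV. p \<in> W k}"
    unfolding strongly_point_finite_def by blast
  have W: "openin (sum_topology (\<lambda>_. X) I) (W k)" "A (r k) \<subseteq> W k"
      "p \<in> I \<times> topspace X \<Longrightarrow> finite {k. p \<in> W k}" for k p
    using W' by auto
  \<comment> \<open>\<open>V k i\<close> contains every \<open>x\<close> with
    \<open>(i, x) \<in> \<Phi> (g (r k))\<close>: a new pair lies in \<open>W k\<close>, and at an
    old pair, one in \<open>G (r k)\<close>, the function \<open>g (r k)\<close> was chosen close to
    \<open>f\<close>.\<close>
  define V where "V = (\<lambda>k i. {x. (i, x) \<in> W k} \<union>
    {x \<in> topspace X. d (g (r k) i x) (f i x) \<in> {..<1 / real (Suc (r k))}})"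
  have "\<exists>\<phi>. continuous_map X (top_of_set {0..1::real}) \<phi> \<and> (\<forall>x. (i, x) \<in> \<Phi> (g (r k)) \<longrightarrow> \<phi> x = 1) \<and>
      (\<forall>x\<in>topspace X - V k i. \<phi> x = 0)" if "i \<in> I" for k i
  proof -
    have "continuous_map X euclideanreal (\<lambda>x. d (g (r k) i x) (f i x))"
      using continuous_map_mdist[of X "metric (M, d)" "g (r k) i" "f i"] cont[OF gT that] cont[OF fT that]
      by (simp add: Yeq)
    then have "openin X {x \<in> topspace X. d (g (r k) i x) (f i x) \<in> {..<1 / real (Suc (r k))}}"
      by (rule openin_continuous_map_preimage) simp
    moreover have "openin X {x. (i, x) \<in> W k}"
      using W(1) that unfolding openin_sum_topology by blast
    ultimately have "openin X (V k i)"
      by (simp add: V_def openin_Un)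
    moreover have "Pair i -` \<Phi> (g (r k)) \<subseteq> V k i"
    proof
      fix x assume x: "x \<in> Pair i -` \<Phi> (g (r k))"
      then have "x \<in> topspace X" using \<Phi>(2)[OF gU] by blast
      then show "x \<in> V k i"
        using x W(2)[of k] g_near[of "(i, x)" "r k"] by (cases "(i, x) \<in> G (r k)") (auto simp: V_def A_def)
    qed
    moreover have "finite (Pair i -` \<Phi> (g (r k)))"
      using \<Phi>(1)[OF gU] by (intro finite_vimageI) (auto simp: inj_on_def)
    ultimately obtain \<phi> where "continuous_map X (top_of_set {0..1::real}) \<phi>"
      "\<And>x. x \<in> Pair i -` \<Phi> (g (r k)) \<Longrightarrow> \<phi> x = 1" "\<And>x. x \<in> topspace X - V k i \<Longrightarrow> \<phi> x = 0"
      using completely_regular_space_finite_openin[OF X(1)] by metis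
    then show ?thesis by blast
  qed
  then have "\<exists>\<phi>. \<forall>i\<in>I. continuous_map X (top_of_set {0..1::real}) (\<phi> i) \<and>
      (\<forall>x. (i, x) \<in> \<Phi> (g (r k)) \<longrightarrow> \<phi> i x = 1) \<and> (\<forall>x\<in>topspace X - V k i. \<phi> i x = 0)" for k
    by (intro bchoice ballI)
  then have "\<exists>\<phi>. \<forall>k. \<forall>i\<in>I. continuous_map X (top_of_set {0..1::real}) (\<phi> k i) \<and>
      (\<forall>x. (i, x) \<in> \<Phi> (g (r k)) \<longrightarrow> \<phi> k i x = 1) \<and> (\<forall>x\<in>topspace X - V k i. \<phi> k i x = 0)"
    by (intro choice allI)
  then obtain \<phi> where \<phi>: "\<And>k i. i \<in> I \<Longrightarrow> continuous_map X (top_of_set {0..1::real}) (\<phi> k i)"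
    "\<And>k i x. i \<in> I \<Longrightarrow> (i, x) \<in> \<Phi> (g (r k)) \<Longrightarrow> \<phi> k i x = 1"
    "\<And>k i x. i \<in> I \<Longrightarrow> x \<in> topspace X - V k i \<Longrightarrow> \<phi> k i x = 0"
    by blast
  \<comment> \<open>In coordinate \<open>i\<close>, \<open>h k\<close> agrees with \<open>f\<close>
    off \<open>V k i\<close>; it agrees with \<open>g (r k)\<close> on the pairs that guarantee
    membership in \<open>U\<close>.\<close>
  define h where "h = (\<lambda>k. \<lambda>i\<in>I. blend X (\<phi> k i) (f i) (g (r k) i))"
  have hT: "h k \<in> topspace ?T" for k
    using fT gT[of "r k"] \<phi>(1) unfolding topT h_def
    by (auto intro!: blend_closed_blend[OF S])
  have "h k \<in> U" for k
  proof (rule \<Phi>(3)[OF gU hT])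
    fix p assume p: "p \<in> \<Phi> (g (r k))"
    then have "p \<in> I \<times> topspace X" using \<Phi>(2)[OF gU] by blast
    then have "fst p \<in> I" "snd p \<in> topspace X" by auto
    then show "h k (fst p) (snd p) = g (r k) (fst p) (snd p)"
      using \<phi>(2)[of "fst p" "snd p" k] p by (simp add: h_def blend_def)
  qed
  moreover have "limitin ?T h f sequentially"
  proof -
    have "limitin Y (\<lambda>k. h k i x) (f i x) sequentially" if "i \<in> I" "x \<in> topspace X" for i x
    proof -
      \<comment> \<open>Where the weight is zero, the value of \<open>g (r k)\<close> does not enter
        the blend and is replaced by the limit. Otherwise \<open>x \<in> V k i\<close>, and for
        large \<open>k\<close>, when \<open>(i, x)\<close> is no longer in \<open>W k\<close>, this
        forces closeness to \<open>f i x\<close>. So \<open>g'\<close> converges even if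
        \<open>g (r k) i x\<close> does not.\<close>
      define g' where "g' = (\<lambda>k. if \<phi> k i x = 0 then f i x else g (r k) i x)"
      have "limitin Y g' (f i x) sequentially"
        unfolding Yeq limit_metric_sequentially
      proof (intro conjI allI impI)
        fix e :: real assume "e > 0"
        have "finite {k. (i, x) \<in> W k}"
          using W(3)[of "(i, x)"] \<open>i \<in> I\<close> \<open>x \<in> topspace X\<close> by simp
        then obtain N1 where N1: "\<And>k. k \<ge> N1 \<Longrightarrow> (i, x) \<notin> W k"
          unfolding finite_nat_set_iff_bounded by (auto simp: not_less[symmetric])
        obtain N2 where N2: "1 / real (Suc N2) < e"
          using \<open>e > 0\<close> nat_approx_posE by blast
        have "d (g' k) (f i x) < e" if k: "k \<ge> max N1 N2" for k
        proof (cases "\<phi> k i x = 0")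
          case False
          then have "x \<in> V k i" using \<phi>(3) \<open>i \<in> I\<close> \<open>x \<in> topspace X\<close> by blast
          then have "d (g (r k) i x) (f i x) < 1 / real (Suc (r k))"
            using N1[of k] k by (simp add: V_def)
          moreover have "1 / real (Suc (r k)) \<le> 1 / real (Suc N2)"
            using strict_mono_imp_increasing[OF r, of k] k by (intro divide_left_mono) auto
          ultimately show ?thesis using False N2 by (simp add: g'_def)
        qed (use \<open>e > 0\<close> in \<open>simp add: g'_def M\<close>)
        then show "\<exists>N. \<forall>k\<ge>N. g' k \<in> M \<and> d (g' k) (f i x) < e"
          using M by blast
      qed (simp add: M)
      moreover have "\<phi> k i x \<in> {0..1}" for k
        using continuous_map_image_subset_topspace[OF \<phi>(1)[OF \<open>i \<in> I\<close>, of k]] \<open>x \<in> topspace X\<close>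
        by (auto simp: image_subset_iff)
      ultimately have "limitin Y (\<lambda>k. (1 - \<phi> k i x) *\<^sub>R f i x + \<phi> k i x *\<^sub>R g' k) (f i x) sequentially"
        by (rule limitin_lcs_blend[OF Y(1)])
      moreover have "(1 - \<phi> k i x) *\<^sub>R f i x + \<phi> k i x *\<^sub>R g' k = h k i x" for k
        using that by (simp add: h_def blend_def g'_def)
      ultimately show ?thesis by simp
    qed
    moreover have "h k i \<in> S" "f i \<in> S" if "i \<in> I" for k i
      using hT fT that unfolding topT by blast+
    moreover have "S \<subseteq> extensional (topspace X)"
      using blend_closed_subset[OF S] by (auto simp: cont_maps_def)
    moreover have "h k \<in> extensional I" "f \<in> extensional I" for k
      using hT fT unfolding topT PiE_def by blast+
    ultimately show ?thesis
      using hT topspace_lcs[OF Y(1)]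
      unfolding power_top_def limitin_componentwise limitin_subtopology
      by (auto simp: subset_iff PiE_def intro!: always_eventually)
  qed
  ultimately show "\<exists>s::nat \<Rightarrow> _. range s \<subseteq> U \<and> limitin ?T s f sequentially" by blast
qed

section \<open>From the sequential Ascoli property to property \<open>(\<kappa>)\<close>\<close>

text \<open>
  If no subsequence of \<open>A\<close> is strongly point-finite, the products over \<open>A n\<close> of the \<open>n\<close>-th bump
  function vanish eventually on every compact set of functions, while functions equal to \<open>z n\<close>
  on \<open>A n\<close> and to \<open>z 0\<close> on a given finite set violate equicontinuity at the constant \<open>z 0\<close>.
\<close>
lemma sequentially_ascoli_space_imp_property_kappa:
  fixes Y :: "'b::real_vector topology"
  assumes Y: "metrizable_space Y" "\<not> compact_space Y"
    and X: "tychonoff_space X" and S: "blend_closed X Y S"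
    and E: "sequentially_ascoli_space (pointwise_top X Y S)" (is "sequentially_ascoli_space ?E")
  shows "property_kappa X"
  unfolding property_kappa_def
proof (intro allI impI, rule ccontr)
  fix A :: "nat \<Rightarrow> 'a set"
  assume "(\<forall>n. finite (A n) \<and> A n \<subseteq> topspace X) \<and> disjoint_family A"
  then have fin: "\<And>n. finite (A n)" and sub: "\<And>n. A n \<subseteq> topspace X" and disj: "disjoint_family A"
    by auto
  assume neg: "\<nexists>r::nat \<Rightarrow> nat. strict_mono r \<and> strongly_point_finite X (A \<circ> r) UNIV"
  obtain z :: "nat \<Rightarrow> 'b" and g :: "nat \<Rightarrow> 'b \<Rightarrow> real"
    where g: "\<And>n. continuous_map Y euclideanreal (g n)" "\<And>n. g n (z n) = 1"
      "\<And>C. compactin Y C \<Longrightarrow> finite {n. \<exists>y\<in>C. g n y \<noteq> 0}"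
    by (rule metrizable_noncompact_bumps[OF Y]) (rule that)
  have topE: "topspace ?E = S"
    by (rule topspace_pointwise_top[OF blend_closed_subset[OF S]])
  define f where "f = (\<lambda>n. \<lambda>h\<in>S. \<Prod>a\<in>A n. g n (h a))"
  have f_cont: "f n \<in> cont_maps ?E euclideanreal" for n
  proof -
    have "continuous_map ?E euclideanreal (\<lambda>h. \<Prod>a\<in>A n. g n (h a))"
    proof (intro continuous_map_prod fin)
      fix a assume "a \<in> A n"
      then have "a \<in> topspace X" using sub by blast
      from continuous_map_compose[OF continuous_map_pointwise_eval[OF this] g(1)]
      show "continuous_map ?E euclideanreal (\<lambda>h. g n (h a))" by (simp add: o_def)
    qed
    then show ?thesis
      unfolding f_def cont_maps_def topE by (auto simp: topE intro: continuous_map_eq)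
  qed
  have vanish: "finite {n. \<exists>h\<in>K. f n h \<noteq> 0}" if K: "compactin ?E K" for K
  proof (rule ccontr)
    have KS: "K \<subseteq> S" using compactin_subset_topspace[OF K] topE by simp
    assume inf: "infinite {n. \<exists>h\<in>K. f n h \<noteq> 0}"
    define r where "r = enumerate {n. \<exists>h\<in>K. f n h \<noteq> 0}"
    have r: "strict_mono r"
      unfolding r_def using strict_mono_enumerate[OF inf] .
    have "\<exists>h\<in>K. f (r k) h \<noteq> 0" for k
      using enumerate_in_set[OF inf, of k] by (simp add: r_def)
    then obtain h where h: "\<And>k. h k \<in> K" "\<And>k. f (r k) (h k) \<noteq> 0"
      by metis
    \<comment> \<open>If \<open>f (r k)\<close> does not vanish at \<open>h k\<close>, all its
      factors are nonzero, so \<open>A (r k) \<subseteq> U k\<close>. At a fixed \<open>x\<close>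
      the members of \<open>K\<close> take values in a compact set, on which only finitely many
      bumps are nonzero; hence the sets \<open>U k\<close> are point-finite, contrary to
      assumption.\<close>
    define U where "U = (\<lambda>k. {x \<in> topspace X. g (r k) (h k x) \<in> - {0}})"
    have "openin X (U k)" for k
    proof -
      have "continuous_map X Y (h k)"
        using h(1) KS blend_closed_subset[OF S] by (auto simp: cont_maps_def)
      from continuous_map_compose[OF this g(1)] show ?thesis
        unfolding U_def by (intro openin_continuous_map_preimage[where Y = euclideanreal]) (auto simp: o_def)
    qed
    moreover have "A (r k) \<subseteq> U k" for k
      using h[of k] KS sub fin by (force simp: U_def f_def)
    moreover have "finite {k. x \<in> U k}" if x: "x \<in> topspace X" for x
    proof -
      have "compactin Y ((\<lambda>h. h x) ` K)"
        by (rule image_compactin[OF K continuous_map_pointwise_eval[OF x]])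
      from finite_vimageI[OF g(3)[OF this] strict_mono_imp_inj_on[OF r]]
      show ?thesis
        by (rule rev_finite_subset) (use h(1) in \<open>auto simp: U_def\<close>)
    qed
    ultimately have "strongly_point_finite X (A \<circ> r) UNIV"
      unfolding strongly_point_finite_def by (intro exI[of _ U]) auto
    then show False using neg r by blast
  qed
  define zf where "zf = (\<lambda>h\<in>S. 0::real)"
  have "limitin (Ck ?E) f zf sequentially"
    unfolding limitin_Ck_iff
  proof (intro conjI allI impI)
    have "continuous_map ?E euclideanreal (\<lambda>h. 0)" by simp
    then show "zf \<in> cont_maps ?E euclideanreal"
      unfolding zf_def cont_maps_def topE by (auto simp: topE intro: continuous_map_eq)
    fix K W assume KW: "compactin ?E K \<and> open W \<and> zf ` K \<subseteq> W"
    then have KS: "K \<subseteq> S" using compactin_subset_topspace topE by blast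
    have "finite {n. \<exists>h\<in>K. f n h \<noteq> 0}" using vanish KW by blast
    then have "\<forall>\<^sub>F n in sequentially. \<forall>h\<in>K. f n h = 0"
      by (simp add: eventually_cofinite flip: cofinite_eq_sequentially)
    then show "\<forall>\<^sub>F n in sequentially. f n \<in> cont_maps ?E euclideanreal \<and> f n ` K \<subseteq> W"
      by (rule eventually_mono) (use KW KS f_cont in \<open>auto simp: zf_def image_subset_iff\<close>)
  qed
  moreover have "range f \<subseteq> topspace (Ck ?E)"
    using f_cont by (auto simp: topspace_Ck)
  ultimately have eq: "equicontinuous ?E (range f)"
    using E unfolding sequentially_ascoli_space_def by blast
  define c where "c = (\<lambda>x\<in>topspace X. z 0)"
  have "c \<in> S" unfolding c_def by (rule blend_closed_const[OF S])
  then obtain W where W: "openin ?E W" "c \<in> W" "\<And>n h. h \<in> W \<Longrightarrow> \<bar>f n h - f n c\<bar> < 1"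
    using eq topE unfolding equicontinuous_def by (metis rangeI zero_less_one)
  obtain F where F: "finite F" "F \<subseteq> topspace X"
    "\<And>h'. h' \<in> S \<Longrightarrow> (\<And>x. x \<in> F \<Longrightarrow> h' x = c x) \<Longrightarrow> h' \<in> W"
    using openin_pointwise_finite[OF W(1,2)] topE by metis
  \<comment> \<open>A singleton is compact, so all but finitely many \<open>f n\<close> vanish at
    \<open>c\<close>. By disjointness only finitely many \<open>A n\<close> meet \<open>F\<close>,
    and the index \<open>n\<close> below is chosen outside both exceptional sets.\<close>
  have "compactin ?E {c}" using \<open>c \<in> S\<close> topE by simp
  from vanish[OF this] have "finite {n. f n c \<noteq> 0}" by simp
  moreover have "finite {n. A n \<inter> F \<noteq> {}}"
  proof -
    have "{n. A n \<inter> F \<noteq> {}} \<subseteq> (\<Union>x\<in>F. {n. x \<in> A n})" by blast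
    moreover have "finite {n. x \<in> A n}" for x
    proof (cases "\<exists>m. x \<in> A m")
      case True
      then obtain m where "x \<in> A m" ..
      then have "{n. x \<in> A n} \<subseteq> {m}"
        using disj by (auto simp: disjoint_family_on_def)
      then show ?thesis by (rule finite_subset) simp
    qed simp
    ultimately show ?thesis
      using finite_subset[OF _ finite_UN_I[OF F(1)]] by blast
  qed
  ultimately have "finite ({n. f n c \<noteq> 0} \<union> {n. A n \<inter> F \<noteq> {}})" by blast
  from ex_new_if_finite[OF infinite_UNIV_nat this]
  obtain n where n: "f n c = 0" "A n \<inter> F = {}" by blast
  have "closedin X F"
    using F(1,2) X closedin_Hausdorff_finite unfolding tychonoff_space_def by blast
  then have "openin X (topspace X - F)" by blast
  moreover have "A n \<subseteq> topspace X - F" using sub n(2) by blast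
  ultimately obtain \<phi> where \<phi>: "continuous_map X (top_of_set {0..1}) \<phi>"
    "\<And>x. x \<in> A n \<Longrightarrow> \<phi> x = (1::real)" "\<And>x. x \<in> topspace X - (topspace X - F) \<Longrightarrow> \<phi> x = 0"
    using completely_regular_space_finite_openin[OF _ fin] X unfolding tychonoff_space_def by metis
  \<comment> \<open>\<open>h\<close> agrees with \<open>c\<close> on \<open>F\<close> and so lies in
    \<open>W\<close>, but its value \<open>z n\<close> on \<open>A n\<close> makes every factor of
    \<open>f n h\<close> equal to one.\<close>
  define h where "h = blend X \<phi> c (\<lambda>x\<in>topspace X. z n)"
  have "h \<in> S"
    unfolding h_def using \<open>c \<in> S\<close> blend_closed_const[OF S] \<phi>(1) by (intro blend_closed_blend[OF S])
  moreover have "h x = c x" if "x \<in> F" for x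
    using that F(2) \<phi>(3)[of x] by (auto simp: h_def blend_def)
  ultimately have "h \<in> W" by (rule F(3))
  moreover have "h x = z n" if "x \<in> A n" for x
    using that sub[of n] \<phi>(2)[of x] by (auto simp: h_def blend_def)
  then have "f n h = 1"
    using \<open>h \<in> S\<close> g(2) by (simp add: f_def)
  ultimately show False using W(3)[of h n] n(1) by simp
qed

section \<open>Equivalence of the conditions for \<open>E\<close> and for its powers\<close>

theorem theorem5p13:
  fixes X :: "'a topology" and Y :: "'b::real_vector topology"
    and E :: "('a \<Rightarrow> 'b) topology"
  assumes Y_lcs: "locally_convex_space Y"
    and Y_metrizable: "metrizable_space Y"
    and Y_nontrivial: "\<exists>y::'b. y \<noteq> 0"
    and X_tychonoff: "tychonoff_space X"
    and E_cases: "E = Cp X Y \<or> E = Cpb X Y \<or> E = Cprc X Y"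
  defines "vii \<equiv> finite (topspace X) \<or> property_kappa X"
  shows
    "(kappa_Frechet_Urysohn E \<longleftrightarrow> vii) \<and>
     ((\<forall>I::'i set. I \<noteq> {} \<longrightarrow> kappa_Frechet_Urysohn (power_top E I)) \<longleftrightarrow> vii) \<and>
     (ascoli_space E \<longleftrightarrow> vii) \<and>
     ((\<forall>I::'i set. I \<noteq> {} \<longrightarrow> ascoli_space (power_top E I)) \<longleftrightarrow> vii) \<and>
     (sequentially_ascoli_space E \<longleftrightarrow> vii) \<and>
     ((\<forall>I::'i set. I \<noteq> {} \<longrightarrow> sequentially_ascoli_space (power_top E I)) \<longleftrightarrow> vii) \<and>
     ((\<exists>I::'i set. I \<noteq> {} \<and> kappa_Frechet_Urysohn (power_top E I)) \<longleftrightarrow> vii) \<and>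
     ((\<exists>I::'i set. I \<noteq> {} \<and> ascoli_space (power_top E I)) \<longleftrightarrow> vii) \<and>
     ((\<exists>I::'i set. I \<noteq> {} \<and> sequentially_ascoli_space (power_top E I)) \<longleftrightarrow> vii)"
proof -
  have "Hausdorff_space Y"
    by (rule metrizable_imp_Hausdorff_space[OF Y_metrizable])
  \<comment> \<open>All three choices of \<open>E\<close> carry the pointwise topology on a set
    closed under blending, which allows a uniform treatment.\<close>
  then obtain S where S: "blend_closed X Y S" and E: "E = pointwise_top X Y S"
    using E_cases blend_closed_cont_maps[OF Y_lcs] blend_closed_bounded[OF Y_lcs]
      blend_closed_relatively_compact[OF Y_lcs] by (metis Cp_def Cpb_eq Cprc_eq)
  have vii: "vii \<longleftrightarrow> property_kappa X"
    unfolding vii_def using property_kappa_finite by blast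
  have tyE: "tychonoff_space E" and tyP: "tychonoff_space (power_top E I)" for I :: "'i set"
    unfolding E using tychonoff_space_pointwise[OF Y_metrizable]
      tychonoff_space_power_pointwise[OF Y_metrizable] by blast+
  have proj: "continuous_map (power_top E J) E (\<lambda>h. h j)" if "j \<in> J" for J :: "'j set" and j
    unfolding power_top_def using that by (rule continuous_map_product_projection)
  have diag: "continuous_map E (power_top E J) (\<lambda>h. \<lambda>i\<in>J. h)" for J :: "'j set"
    unfolding power_top_def continuous_map_componentwise by auto

  have kappa_power: "kappa_Frechet_Urysohn (power_top E J)" if vii for J :: "'j set"
    using property_kappa_imp_kappa_Frechet_Urysohn_power[OF Y_lcs Y_metrizable _ _ S]
      X_tychonoff that unfolding vii E tychonoff_space_def by blast
  \<comment> \<open>\<open>E\<close> is a retract of a power indexed by a whole type: the diagonal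
    followed by a coordinate projection is the identity.\<close>
  have kappa: "kappa_Frechet_Urysohn E" if vii
    by (rule kappa_Frechet_Urysohn_retraction[OF proj diag _ kappa_power[OF that]], rule UNIV_I) simp
  have converse: vii if "sequentially_ascoli_space E"
    using sequentially_ascoli_space_imp_property_kappa[OF Y_metrizable _ X_tychonoff S]
      lcs_not_compact_space[OF Y_lcs Y_metrizable] Y_nontrivial that unfolding vii E by blast
  have converse_power: vii if seq: "sequentially_ascoli_space (power_top E I)" and "I \<noteq> {}" for I :: "'i set"
  proof -
    obtain i where "i \<in> I" using \<open>I \<noteq> {}\<close> by blast
    then show ?thesis
      by (intro converse sequentially_ascoli_space_retraction[OF proj diag _ tyE seq]) auto
  qed
  have "kappa_Frechet_Urysohn E \<longleftrightarrow> vii" "ascoli_space E \<longleftrightarrow> vii" "sequentially_ascoli_space E \<longleftrightarrow> vii"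
    using kappa converse kappa_Frechet_Urysohn_imp_ascoli_space[OF tyE]
      ascoli_space_imp_sequentially_ascoli_space by blast+
  moreover have "kappa_Frechet_Urysohn (power_top E I) \<longleftrightarrow> vii" "ascoli_space (power_top E I) \<longleftrightarrow> vii"
    "sequentially_ascoli_space (power_top E I) \<longleftrightarrow> vii" if "I \<noteq> {}" for I :: "'i set"
    using kappa_power converse_power[OF _ that] kappa_Frechet_Urysohn_imp_ascoli_space[OF tyP]
      ascoli_space_imp_sequentially_ascoli_space by blast+
  \<comment> \<open>A non-empty index set is what lets a statement about all powers give
    \<open>vii\<close>, and \<open>vii\<close> give one about some power.\<close>
  moreover have "(UNIV :: 'i set) \<noteq> {}" by simp
  ultimately show ?thesis by blast
qed

end
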